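(* Consider the group-sequential testing problem of $H_0:\theta=\theta_0$ against $H_1:\theta=\theta_1$ described in the context, with identically distributed group sizes with common probability mass function $p$ on $\mathscr G$. Let $A<B$ be two positive constants. Let $\psi$ be any stopping rule satisfying $$I_{\{z_n\in(A,B)\}}\le 1-\psi_n\le I_{\{z_n\in[A,B]\}}$$ for all $n\in\mathscr G^k$ and $k=1,2,\dots$, and let $\phi$ be the decision rule defined by $$\phi_n=I_{\{z_n\ge B\}}$$ for all $n\in\mathscr G^k$ and $k=1,2,\dots$. Then $(\psi,\phi)\in\mathscr S_0\cap\mathscr S_1$, and it is optimal in the following sense: for any group-sequential test $(\psi',\phi')\in\mathscr S_0\cap\mathscr S_1$ such that $$\alpha(\psi',\phi')\le\alpha(\psi,\phi)\quad\text{and}\quad\beta(\psi',\phi')\le\beta(\psi,\phi),\qquad(1)$$ it holds $$K_0(\psi)\le K_0(\psi')\quad\text{and}\quad K_1(\psi)\le K_1(\psi').\qquad(2)$$ Both inequalities in (2) are strict if at least one of the inequalities in (1) is strict.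
   Context: Setting. Observations arrive in groups $k=1,2,\dots$ of random sizes $\nu_1,\nu_2,\dots$, which are independent and identically distributed with values in $\mathscr G\subset\{0,1,2,\dots\}$ and known p.m.f. $p(m)=P(\nu_k=m)$, $m\in\mathscr G$. For $n=(n_1,\dots,n_k)\in\mathscr G^k$ put $p(n)=\prod_{i=1}^kp(n_i)$. Given the group sizes, all observations $X_{ij}$ ($j\le n_i$, $i\le k$) are i.i.d. with values in a measurable space $(\mathfrak X,\mathscr X)$ and density $f_\theta$ with respect to a $\sigma$-finite measure $\mu$. Thus, given sizes $n$, the data $X^{(n)}=(X_1^{(n_1)},\dots,X_k^{(n_k)})$, $X_i^{(n_i)}=(X_{i1},\dots,X_{in_i})$, has density $f_\theta^{(n)}(x^{(n)})=\prod_{i=1}^k\prod_{j=1}^{n_i}f_\theta(x_{ij})$ with respect to $\mu^n=\mu^{n_1}\otimes\cdots\otimes\mu^{n_k}$ on $\mathfrak X^n=\mathfrak X^{n_1}\times\cdots\times\mathfrak X^{n_k}$ (empty products are $1$; $\mathfrak X^0$ is a one-point space and $\mu^0$ a probability measure on it). For a function $F_n$ on $\mathfrak X^n$, $E_\theta F_n=\int F_nf_\theta^{(n)}d\mu^n$. Write $f_i,E_i,P_i$ for $f_{\theta_i},E_{\theta_i},P_{\theta_i}$, $i=0,1$. It is assumed that $\mu\{x:f_0(x)\ne f_1(x)\}>0$. Tests. A stopping rule $\psi$ is a family of measurable functions $\psi_n:\mathfrak X^n\to[0,1]$, $n\in\mathscr G^k$, $k\ge1$ (conditional probability of stopping after the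 observed groups); a decision rule $\phi$ is a family of measurable $\phi_n:\mathfrak X^n\to[0,1]$ (conditional probability of rejecting $H_0$). A group-sequential test is a pair $(\psi,\phi)$. For $n=(n_1,\dots,n_k)$ let $t_n^\psi(x^{(n)})=\prod_{i=1}^{k-1}\bigl(1-\psi_{(n_1,\dots,n_i)}(x_1^{(n_1)},\dots,x_i^{(n_i)})\bigr)$ (equal to $1$ for $k=1$) and $s_n^\psi=t_n^\psi\psi_n$. $\mathscr F_i$ is the set of stopping rules with $\sum_{k\ge1}\sum_{n\in\mathscr G^k}p(n)E_is_n^\psi=1$; $\mathscr S_i$ is the set of tests $(\psi,\phi)$ with $\psi\in\mathscr F_i$, $i=0,1$. Error probabilities: $\alpha(\psi,\phi)=\sum_{k\ge1}\sum_{n\in\mathscr G^k}p(n)E_0s_n^\psi\phi_n$, $\beta(\psi,\phi)=\sum_{k\ge1}\sum_{n\in\mathscr G^k}p(n)E_1s_n^\psi(1-\phi_n)$. Costs: a group of $m$ observations costs $c(m)>0$, $m\in\mathscr G$; $c(n)=\sum_{i=1}^kc(n_i)$ for $n\in\mathscr G^k$; it is assumed that $\bar c=\sum_{m\in\mathscr G}p(m)c(m)$ satisfies $0<\bar c<\infty$. The average cost under $H_i$ is $K_i(\psi)=\sum_{k\ge1}\sum_{n\in\mathscr G^k}p(n)c(n)E_is_n^\psi\in[0,\infty]$. Likelihood ratio: $z_n=z_n(x^{(n)})=f_1^{(n)}(x^{(n)})/f_0^{(n)}(x^{(n)})$ if $f_0^{(n)}(x^{(n)})>0$, $z_n=\infty$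 if $f_0^{(n)}(x^{(n)})=0<f_1^{(n)}(x^{(n)})$, and $z_n=0$ (or any other value) otherwise.
   Formalization: The formal theorem additionally assumes p(0)<1 (group sizes are not almost surely zero); if p(0)=1 and A<1<B, then z_n=1 always, the test never stops, and the claim (ψ,φ)∈S_0∩S_1 fails. *)

theory Defs
  imports "HOL-Probability.Probability"
begin

text \<open>
  A vector of group sizes \<open>n = (n\<^sub>1, \<dots>, n\<^sub>k)\<close> is a list of length \<open>k\<close>. Groups and the observations
  within a group are counted from 0, so the observation \<open>x\<^sub>i\<^sub>j\<close> is \<open>x (i - 1) (j - 1)\<close>.
\<close>

type_synonym 'a sample = "nat \<Rightarrow> nat \<Rightarrow> 'a"

type_synonym 'a rule = "nat list \<Rightarrow> 'a sample \<Rightarrow> real"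

definition size_vectors :: "nat set \<Rightarrow> nat \<Rightarrow> nat list set" where
  "size_vectors G k = {n. length n = k \<and> set n \<subseteq> G}"

definition size_prob :: "nat pmf \<Rightarrow> nat list \<Rightarrow> real" where
  "size_prob p n = (\<Prod>i<length n. pmf p (n ! i))"

definition total_cost :: "(nat \<Rightarrow> real) \<Rightarrow> nat list \<Rightarrow> real" where
  "total_cost c n = (\<Sum>i<length n. c (n ! i))"

text \<open>
  The measure \<open>\<mu>\<^sup>n\<close> on the sample space of the observed groups. A group of size 0 contributes the
  factor \<open>PiM {} (\<lambda>_. M)\<close>, which is a one-point probability space.
\<close>

definition sample_measure :: "'a measure \<Rightarrow> nat list \<Rightarrow> 'a sample measure" where
  "sample_measure M n = PiM {..<length n} (\<lambda>i. PiM {..<n ! i} (\<lambda>_. M))"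

definition joint_density :: "('a \<Rightarrow> real) \<Rightarrow> nat list \<Rightarrow> 'a sample \<Rightarrow> real" where
  "joint_density f n x = (\<Prod>i<length n. \<Prod>j<n ! i. f (x i j))"

text \<open>
  The expectation \<open>E\<^sub>\<theta> F\<close> for the density \<open>f = f\<^sub>\<theta>\<close>. It is only needed for nonnegative \<open>F\<close>, so it is
  taken with values in \<open>[0, \<infinity>]\<close>.
\<close>

definition sample_expectation ::
  "'a measure \<Rightarrow> ('a \<Rightarrow> real) \<Rightarrow> nat list \<Rightarrow> ('a sample \<Rightarrow> real) \<Rightarrow> ennreal" where
  "sample_expectation M f n F =
     (\<integral>\<^sup>+ x. ennreal (F x * joint_density f n x) \<partial>sample_measure M n)"

text \<open>Stopping rules and decision rules are subject to the same requirements.\<close>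

definition randomized_rule :: "'a measure \<Rightarrow> nat set \<Rightarrow> 'a rule \<Rightarrow> bool" where
  "randomized_rule M G r \<longleftrightarrow>
     (\<forall>k\<ge>1. \<forall>n\<in>size_vectors G k.
        r n \<in> borel_measurable (sample_measure M n) \<and>
        (\<forall>x\<in>space (sample_measure M n). 0 \<le> r n x \<and> r n x \<le> 1))"

text \<open>
  The first \<open>i\<close> groups of the data \<open>x\<close> are \<open>restrict x {..<i}\<close>, a point of the sample space for
  the sizes \<open>take i n\<close>.
\<close>

definition continue_prob :: "'a rule \<Rightarrow> 'a rule" where
  "continue_prob \<psi> n x = (\<Prod>i\<in>{1..<length n}. 1 - \<psi> (take i n) (restrict x {..<i}))"

definition stop_prob :: "'a rule \<Rightarrow> 'a rule" where
  "stop_prob \<psi> n x = continue_prob \<psi> n x * \<psi> n x"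

text \<open>The average \<open>\<Sum>\<^sub>k \<Sum>\<^sub>n p(n) g(n)\<close> over all stages \<open>k \<ge> 1\<close> and all size vectors \<open>n\<close> of length \<open>k\<close>.\<close>

definition stage_sum :: "nat pmf \<Rightarrow> nat set \<Rightarrow> (nat list \<Rightarrow> ennreal) \<Rightarrow> ennreal" where
  "stage_sum p G g =
     (\<Sum>\<^sub>\<infinity>k\<in>{1..}. \<Sum>\<^sub>\<infinity>n\<in>size_vectors G k. ennreal (size_prob p n) * g n)"

definition terminating_rules ::
  "'a measure \<Rightarrow> nat set \<Rightarrow> nat pmf \<Rightarrow> ('a \<Rightarrow> real) \<Rightarrow> 'a rule set" where
  "terminating_rules M G p f =
     {\<psi>. randomized_rule M G \<psi> \<and>
         stage_sum p G (\<lambda>n. sample_expectation M f n (stop_prob \<psi> n)) = 1}"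

definition terminating_tests ::
  "'a measure \<Rightarrow> nat set \<Rightarrow> nat pmf \<Rightarrow> ('a \<Rightarrow> real) \<Rightarrow> ('a rule \<times> 'a rule) set" where
  "terminating_tests M G p f =
     {(\<psi>, \<phi>). \<psi> \<in> terminating_rules M G p f \<and> randomized_rule M G \<phi>}"

definition error_prob1 ::
  "'a measure \<Rightarrow> nat set \<Rightarrow> nat pmf \<Rightarrow> ('a \<Rightarrow> real) \<Rightarrow> 'a rule \<Rightarrow> 'a rule \<Rightarrow> ennreal" where
  "error_prob1 M G p f0 \<psi> \<phi> =
     stage_sum p G (\<lambda>n. sample_expectation M f0 n (\<lambda>x. stop_prob \<psi> n x * \<phi> n x))"

definition error_prob2 ::
  "'a measure \<Rightarrow> nat set \<Rightarrow> nat pmf \<Rightarrow> ('a \<Rightarrow> real) \<Rightarrow> 'a rule \<Rightarrow> 'a rule \<Rightarrow> ennreal" where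
  "error_prob2 M G p f1 \<psi> \<phi> =
     stage_sum p G (\<lambda>n. sample_expectation M f1 n (\<lambda>x. stop_prob \<psi> n x * (1 - \<phi> n x)))"

definition average_cost ::
  "'a measure \<Rightarrow> nat set \<Rightarrow> nat pmf \<Rightarrow> (nat \<Rightarrow> real) \<Rightarrow> ('a \<Rightarrow> real) \<Rightarrow> 'a rule \<Rightarrow> ennreal" where
  "average_cost M G p c f \<psi> =
     stage_sum p G (\<lambda>n. ennreal (total_cost c n) * sample_expectation M f n (stop_prob \<psi> n))"

text \<open>
  The likelihood ratio \<open>z\<^sub>n\<close>. Its value where both densities vanish is a matter of convention and
  is left as the parameter \<open>z00\<close>.
\<close>

definition likelihood_ratio ::
  "('a \<Rightarrow> real) \<Rightarrow> ('a \<Rightarrow> real) \<Rightarrow> ennreal \<Rightarrow> nat list \<Rightarrow> 'a sample \<Rightarrow> ennreal" where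
  "likelihood_ratio f0 f1 z00 n x =
     (if joint_density f0 n x > 0 then ennreal (joint_density f1 n x / joint_density f0 n x)
      else if joint_density f1 n x > 0 then \<infinity>
      else z00)"

end

theory Submission
  imports Defs
begin

text \<open>
  Fix costs \<open>a0\<close>, \<open>a1\<close> per group under the two hypotheses and losses \<open>l0\<close>, \<open>l1\<close> for the two errors.
  Expressed in the pair \<open>(x, y)\<close> of joint densities instead of their ratio, the Bayes risk \<open>v\<close> solves
  \<open>v = min (l0 x, l1 y, h)\<close>, where \<open>h (x, y) = a0 x + a1 y + E v\<close> is the risk of taking one more group,
  and \<open>h\<close> is superadditive and homogeneous. If \<open>h (1, B) = l0\<close> and \<open>h (1, A) = l1 A\<close>, these two
  properties alone show that \<open>v = l1 y\<close> for \<open>y \<le> A x\<close>, \<open>v = l0 x\<close> for \<open>y \<ge> B x\<close> and \<open>v = h\<close> in between,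
  so that the given test minimizes the Lagrangian \<open>a0 K0 + a1 K1 + l0 \<alpha> + l1 \<beta>\<close>. Losses with these
  boundary values are a fixed point of a monotone map, and the choices \<open>(a0, a1) = (1, 0)\<close> and \<open>(0, 1)\<close>,
  up to the mean group cost, give the two inequalities. Termination and the finiteness of the losses
  come from the Hellinger affinity \<open>\<integral> sqrt (f0 f1) < 1\<close>.
\<close>

section \<open>Groups of random size\<close>

text \<open>Working with the pair \<open>(x, y)\<close> keeps the points where a density vanishes
  inside the state space, so an infinite or undefined ratio needs no special treatment in the
  recursion. Superadditivity of a nonnegative function makes it monotone in each variable, and
  moving points onto the two boundary rays is then the whole optimal stopping argument. The
  thresholds are prescribed and the losses are not: for each choice of \<open>a0\<close> and
  \<open>a1\<close> the losses are fitted to the same \<open>A\<close> and \<open>B\<close>, which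
  is why one test minimizes Lagrangians with different multipliers. The lattice of pairs of extended
  reals supplies the fixed point without any continuity in the losses. Prices per group suffice
  although costs depend on the size, because a group is bought before its size is known: by Wald's
  identity the average cost is the mean group cost times the expected number of groups. Finiteness
  of the minimal Lagrangian allows the error terms to be cancelled, and positivity of the losses
  turns a strict error inequality into a strict cost inequality.\<close>

lemma infsum_eq_nn_integral_count_space:
  fixes f :: "'b :: countable \<Rightarrow> ennreal"
  shows "infsum f S = (\<integral>\<^sup>+x. f x \<partial>count_space S)"
proof -
  define g where "g i = (if i \<in> to_nat ` S then f (from_nat i) else 0)" for i
  have inj: "inj_on to_nat S"
    by (metis inj_on_subset inj_to_nat subset_UNIV)
  have "infsum f S = infsum (\<lambda>i. f (from_nat i)) (to_nat ` S)"
    by (simp add: infsum_reindex[OF inj] comp_def)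
  also have "\<dots> = infsum g UNIV"
    by (rule infsum_cong_neutral) (auto simp: g_def)
  also have "\<dots> = (\<Sum>i. g i)"
    using has_sum_imp_sums[OF has_sum_infsum[OF nonneg_summable_on_complete[of UNIV g]]] sums_unique
    by auto
  also have "\<dots> = (\<integral>\<^sup>+i. g i \<partial>count_space UNIV)"
    by (simp add: nn_integral_count_space_nat)
  also have "\<dots> = (\<integral>\<^sup>+i. f (from_nat i) \<partial>count_space (to_nat ` S))"
    by (subst nn_integral_count_space_eq[of UNIV "to_nat ` S" g]) (auto simp: g_def intro!: nn_integral_cong)
  also have "\<dots> = (\<integral>\<^sup>+x. f x \<partial>count_space S)"
    by (subst nn_integral_bij_count_space[symmetric, OF inj_on_imp_bij_betw[OF inj]]) simp
  finally show ?thesis .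
qed

lemma nn_integral_pmf_eq_suminf:
  fixes f :: "nat \<Rightarrow> ennreal"
  shows "(\<integral>\<^sup>+m. f m \<partial>measure_pmf p) = (\<Sum>m. ennreal (pmf p m) * f m)"
  by (simp add: nn_integral_measure_pmf nn_integral_count_space_nat)

lemma infsum_pmf_eq_nn_integral:
  fixes g :: "'b :: countable \<Rightarrow> ennreal"
  assumes "set_pmf q \<subseteq> S"
  shows "(\<Sum>\<^sub>\<infinity>n\<in>S. ennreal (pmf q n) * g n) = (\<integral>\<^sup>+n. g n \<partial>measure_pmf q)"
proof -
  have "(\<integral>\<^sup>+n. ennreal (pmf q n) * g n \<partial>count_space S) =
      (\<integral>\<^sup>+n. ennreal (pmf q n) * g n \<partial>count_space UNIV)"
    by (rule nn_integral_count_space_eq) (use assms in \<open>auto simp: set_pmf_iff\<close>)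
  then show ?thesis
    by (simp add: infsum_eq_nn_integral_count_space nn_integral_measure_pmf)
qed

text \<open>The joint law of the first \<open>k\<close> sizes. Appending at the right end matches
  the growth of a sample, so passing to the next stage only splits off the last group; as a
  probability measure it turns sums over size vectors into integrals.\<close>

primrec sizes_pmf :: "nat pmf \<Rightarrow> nat \<Rightarrow> nat list pmf" where
  "sizes_pmf p 0 = return_pmf []"
| "sizes_pmf p (Suc k) = map_pmf (\<lambda>(n, m). n @ [m]) (pair_pmf (sizes_pmf p k) p)"

lemma set_sizes_pmf:
  assumes "set_pmf p \<subseteq> G"
  shows "set_pmf (sizes_pmf p k) \<subseteq> size_vectors G k"
  using assms by (induction k) (fastforce simp: size_vectors_def)+

lemma pmf_sizes_pmf: "length n = k \<Longrightarrow> pmf (sizes_pmf p k) n = size_prob p n"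
proof (induction k arbitrary: n)
  case 0
  then show ?case by (simp add: size_prob_def)
next
  case (Suc k)
  then obtain n' m where n: "n = n' @ [m]" "length n' = k"
    by (metis length_Suc_conv_rev)
  have "inj (\<lambda>(n, m). n @ [m] :: nat list)"
    by (auto simp: inj_def)
  from pmf_map_inj'[OF this, of "pair_pmf (sizes_pmf p k) p" "(n', m)"]
  have "pmf (sizes_pmf p (Suc k)) n = size_prob p n' * pmf p m"
    using Suc.IH n by (simp add: pmf_pair)
  also have "\<dots> = size_prob p n"
    using n by (simp add: size_prob_def nth_append)
  finally show ?case .
qed

text \<open>The support of \<open>p\<close> lies in \<open>G\<close>, so the vectors in
  \<open>size_vectors G k\<close> carry the whole mass of \<open>sizes_pmf p k\<close>. Stages start
  at 1, hence the shift to \<open>Suc k\<close>.\<close>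

lemma stage_sum_eq_suminf:
  assumes "set_pmf p \<subseteq> G"
  shows "stage_sum p G g = (\<Sum>k. \<integral>\<^sup>+n. g n \<partial>sizes_pmf p (Suc k))"
proof -
  have inner: "(\<Sum>\<^sub>\<infinity>n\<in>size_vectors G k. ennreal (size_prob p n) * g n) = (\<integral>\<^sup>+n. g n \<partial>sizes_pmf p k)" for k
  proof -
    have "(\<Sum>\<^sub>\<infinity>n\<in>size_vectors G k. ennreal (size_prob p n) * g n) =
        (\<Sum>\<^sub>\<infinity>n\<in>size_vectors G k. ennreal (pmf (sizes_pmf p k) n) * g n)"
      by (rule infsum_cong) (auto simp: size_vectors_def pmf_sizes_pmf)
    then show ?thesis
      by (simp add: infsum_pmf_eq_nn_integral[OF set_sizes_pmf[OF assms]])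
  qed
  have "{1..} = range Suc"
    by (auto simp: image_def) (metis Suc_le_D)
  then have "stage_sum p G g = infsum (\<lambda>k. \<integral>\<^sup>+n. g n \<partial>sizes_pmf p (Suc k)) UNIV"
    unfolding stage_sum_def inner by (simp add: infsum_reindex comp_def del: sizes_pmf.simps)
  then show ?thesis
    by (simp add: infsum_eq_nn_integral_count_space nn_integral_count_space_nat del: sizes_pmf.simps)
qed

section \<open>Sample spaces and joint densities when a group is appended\<close>

lemma sample_measure_snoc:
  "sample_measure M (n @ [m]) =
     PiM (insert (length n) {..<length n}) (\<lambda>i. PiM {..<(n @ [m]) ! i} (\<lambda>_. M))"
  by (simp add: sample_measure_def lessThan_Suc)

text \<open>The integration rule for an inserted index needs one family of factors for the old and
  the new index set; indices below \<open>length n\<close> do not see the appended sizes.\<close>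

lemma sample_measure_append:
  "sample_measure M n = PiM {..<length n} (\<lambda>i. PiM {..<(n @ l) ! i} (\<lambda>_. M))"
  unfolding sample_measure_def by (rule PiM_cong) (auto simp: nth_append)

lemma restrict_space_sample_measure:
  assumes "x \<in> space (sample_measure M n)"
  shows "restrict x {..<length n} = x"
  using assms by (simp add: sample_measure_def space_PiM PiE_restrict)

lemma measurable_prefix [measurable]:
  "(\<lambda>x. restrict x {..<i}) \<in> sample_measure M n \<rightarrow>\<^sub>M sample_measure M (take i n)" if "i \<le> length n"
proof -
  have "sample_measure M (take i n) = PiM {..<i} (\<lambda>i. PiM {..<n ! i} (\<lambda>_. M))"
    unfolding sample_measure_def using that by (intro PiM_cong) auto
  moreover have "(\<lambda>x. restrict x {..<i}) \<in> sample_measure M n \<rightarrow>\<^sub>M PiM {..<i} (\<lambda>i. PiM {..<n ! i} (\<lambda>_. M))"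
    unfolding sample_measure_def using that by (intro measurable_restrict_subset) auto
  ultimately show ?thesis by simp
qed

lemma measurable_joint_density [measurable]:
  assumes [measurable]: "f \<in> borel_measurable M"
  shows "joint_density f n \<in> borel_measurable (sample_measure M n)"
proof -
  have "(\<lambda>x. f (x i j)) \<in> borel_measurable (sample_measure M n)" if "i < length n" "j < n ! i" for i j
  proof -
    have [measurable]: "(\<lambda>x. x i) \<in> sample_measure M n \<rightarrow>\<^sub>M PiM {..<n ! i} (\<lambda>_. M)"
      unfolding sample_measure_def using that by (intro measurable_component_singleton) auto
    have [measurable]: "(\<lambda>w. w j) \<in> PiM {..<n ! i} (\<lambda>_. M) \<rightarrow>\<^sub>M M"
      using that by (intro measurable_component_singleton) auto
    show ?thesis by measurable
  qed
  then show ?thesis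
    unfolding joint_density_def by (intro borel_measurable_prod) auto
qed

definition group_density :: "('a \<Rightarrow> real) \<Rightarrow> nat \<Rightarrow> (nat \<Rightarrow> 'a) \<Rightarrow> real" where
  "group_density f m w = (\<Prod>j<m. f (w j))"

lemma joint_density_update:
  "joint_density f (n @ [m]) (x(length n := w)) = joint_density f n x * group_density f m w"
  by (simp add: joint_density_def group_density_def nth_append)

lemma measurable_group_density [measurable]:
  assumes [measurable]: "f \<in> borel_measurable M"
  shows "group_density f m \<in> borel_measurable (PiM {..<m} (\<lambda>_. M))"
  unfolding group_density_def
proof (intro borel_measurable_prod)
  fix j assume "j \<in> {..<m}"
  then have [measurable]: "(\<lambda>w. w j) \<in> PiM {..<m} (\<lambda>_. M) \<rightarrow>\<^sub>M M"
    by (intro measurable_component_singleton) auto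
  show "(\<lambda>w. f (w j)) \<in> borel_measurable (PiM {..<m} (\<lambda>_. M))" by measurable
qed

lemma group_density_nonneg:
  assumes "\<And>x. x \<in> space M \<Longrightarrow> 0 \<le> f x" "w \<in> space (PiM {..<m} (\<lambda>_. M))"
  shows "0 \<le> group_density f m w"
  using assms unfolding group_density_def by (auto intro!: prod_nonneg simp: space_PiM PiE_iff)

lemma joint_density_nonneg:
  assumes "\<And>x. x \<in> space M \<Longrightarrow> 0 \<le> f x" "x \<in> space (sample_measure M n)"
  shows "0 \<le> joint_density f n x"
  using assms unfolding joint_density_def sample_measure_def
  by (fastforce intro!: prod_nonneg simp: space_PiM PiE_iff)

context sigma_finite_measure
begin

lemma sigma_finite_group: "sigma_finite_measure (PiM {..<m::nat} (\<lambda>_. M))"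
  by (rule product_sigma_finite.sigma_finite[OF product_sigma_finite.intro])
    (auto simp: sigma_finite_measure_axioms)

lemma nn_integral_group_density:
  assumes [measurable]: "f \<in> borel_measurable M" and nn: "\<And>x. x \<in> space M \<Longrightarrow> 0 \<le> f x"
  shows "(\<integral>\<^sup>+w. ennreal (group_density f m w) \<partial>PiM {..<m} (\<lambda>_. M)) = (\<integral>\<^sup>+x. ennreal (f x) \<partial>M) ^ m"
proof -
  interpret product_sigma_finite "\<lambda>_::nat. M"
    by (rule product_sigma_finite.intro) (rule sigma_finite_measure_axioms)
  have "(\<integral>\<^sup>+w. ennreal (group_density f m w) \<partial>PiM {..<m} (\<lambda>_. M)) =
      (\<integral>\<^sup>+w. (\<Prod>j<m. ennreal (f (w j))) \<partial>PiM {..<m} (\<lambda>_. M))"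
    unfolding group_density_def
    by (intro nn_integral_cong prod_ennreal[symmetric]) (auto simp: space_PiM PiE_iff nn)
  also have "\<dots> = (\<Prod>j<m. \<integral>\<^sup>+x. ennreal (f x) \<partial>M)"
    by (rule product_nn_integral_prod) auto
  finally show ?thesis by simp
qed

lemma nn_integral_mult_group_density:
  assumes [measurable]: "f \<in> borel_measurable M" and "\<And>x. x \<in> space M \<Longrightarrow> 0 \<le> f x"
    and "(\<integral>\<^sup>+x. ennreal (f x) \<partial>M) = 1" and "0 \<le> t"
  shows "(\<integral>\<^sup>+w. ennreal (t * group_density f m w) \<partial>PiM {..<m} (\<lambda>_. M)) = ennreal t"
proof -
  have "(\<integral>\<^sup>+w. ennreal (t * group_density f m w) \<partial>PiM {..<m} (\<lambda>_. M)) =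
      (\<integral>\<^sup>+w. ennreal t * ennreal (group_density f m w) \<partial>PiM {..<m} (\<lambda>_. M))"
    using assms by (intro nn_integral_cong ennreal_mult group_density_nonneg[of M]) auto
  then show ?thesis
    using assms by (simp add: nn_integral_cmult nn_integral_group_density)
qed

lemma product_sigma_finite_groups: "product_sigma_finite (\<lambda>i. PiM {..<l i :: nat} (\<lambda>_. M))"
  by (rule product_sigma_finite.intro) (rule sigma_finite_group)

lemma nn_integral_sample_measure_snoc:
  assumes "f \<in> borel_measurable (sample_measure M (n @ [m]))"
  shows "(\<integral>\<^sup>+x. f x \<partial>sample_measure M (n @ [m])) =
    (\<integral>\<^sup>+x. \<integral>\<^sup>+w. f (x(length n := w)) \<partial>PiM {..<m} (\<lambda>_. M) \<partial>sample_measure M n)"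
  using assms unfolding sample_measure_snoc sample_measure_append[of M n "[m]"]
  by (subst product_sigma_finite.product_nn_integral_insert[OF product_sigma_finite_groups]) auto

lemma measurable_sample_measure_update [measurable]:
  "(\<lambda>(x, w). x(length n := w)) \<in>
     sample_measure M n \<Otimes>\<^sub>M PiM {..<m} (\<lambda>_. M) \<rightarrow>\<^sub>M sample_measure M (n @ [m])"
  unfolding sample_measure_snoc sample_measure_append[of M n "[m]"]
  using measurable_add_dim[of "length n" "{..<length n}" "\<lambda>i. PiM {..<(n @ [m]) ! i} (\<lambda>_. M)"]
  by simp

end

section \<open>The Bayes risk as a function of the two densities\<close>

lemma measurable_curried:
  assumes "case_prod F \<in> borel_measurable (borel \<Otimes>\<^sub>M borel)"
    and "g \<in> borel_measurable N" "h \<in> borel_measurable N"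
  shows "(\<lambda>w. F (g w :: real) (h w :: real) :: ennreal) \<in> borel_measurable N"
  using measurable_compose[OF measurable_Pair[OF assms(2,3)] assms(1)] by simp

locale two_densities = sigma_finite_measure M for M :: "'a measure" +
  fixes f0 f1 :: "'a \<Rightarrow> real" and p :: "nat pmf"
  assumes f0_measurable [measurable]: "f0 \<in> borel_measurable M"
    and f0_nonneg: "\<And>x. x \<in> space M \<Longrightarrow> 0 \<le> f0 x"
    and f0_integral: "(\<integral>\<^sup>+x. ennreal (f0 x) \<partial>M) = 1"
    and f1_measurable [measurable]: "f1 \<in> borel_measurable M"
    and f1_nonneg: "\<And>x. x \<in> space M \<Longrightarrow> 0 \<le> f1 x"
    and f1_integral: "(\<integral>\<^sup>+x. ennreal (f1 x) \<partial>M) = 1"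
    and densities_differ: "emeasure M {x \<in> space M. f0 x \<noteq> f1 x} > 0"
    and group_nontrivial: "pmf p 0 < 1"
begin

abbreviation group_measure :: "nat \<Rightarrow> (nat \<Rightarrow> 'a) measure" where
  "group_measure m \<equiv> PiM {..<m} (\<lambda>_. M)"

lemma group_density0_nonneg: "w \<in> space (group_measure m) \<Longrightarrow> 0 \<le> group_density f0 m w"
  and group_density1_nonneg: "w \<in> space (group_measure m) \<Longrightarrow> 0 \<le> group_density f1 m w"
  by (auto intro: group_density_nonneg f0_nonneg f1_nonneg)

text \<open>The one-step operator of the pair of joint densities. It integrates against the
  dominating measure, and the densities sit in the arguments of \<open>F\<close>, so a single
  operator serves both hypotheses.\<close>

definition next_group :: "(real \<Rightarrow> real \<Rightarrow> ennreal) \<Rightarrow> real \<Rightarrow> real \<Rightarrow> ennreal" where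
  "next_group F x y =
     (\<integral>\<^sup>+m. \<integral>\<^sup>+w. F (x * group_density f0 m w) (y * group_density f1 m w) \<partial>group_measure m \<partial>p)"

lemma measurable_next_group_integrand:
  fixes F :: "real \<Rightarrow> real \<Rightarrow> ennreal"
  assumes "case_prod F \<in> borel_measurable (borel \<Otimes>\<^sub>M borel)"
  shows "(\<lambda>w. F (x * group_density f0 m w) (y * group_density f1 m w)) \<in> borel_measurable (group_measure m)"
  by (rule measurable_curried[OF assms]) auto

lemma measurable_next_group:
  assumes "case_prod F \<in> borel_measurable (borel \<Otimes>\<^sub>M borel)"
  shows "case_prod (next_group F) \<in> borel_measurable (borel \<Otimes>\<^sub>M borel)"
proof -
  have "(\<lambda>z. \<integral>\<^sup>+w. F (fst z * group_density f0 m w) (snd z * group_density f1 m w) \<partial>group_measure m)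
      \<in> borel_measurable (borel \<Otimes>\<^sub>M borel)" for m
    by (rule sigma_finite_measure.borel_measurable_nn_integral[OF sigma_finite_group])
      (auto simp: case_prod_unfold intro!: measurable_curried[OF assms])
  then show ?thesis
    unfolding next_group_def nn_integral_pmf_eq_suminf by (simp add: case_prod_unfold)
qed

lemma next_group_mono:
  assumes "\<And>x y. 0 \<le> x \<Longrightarrow> 0 \<le> y \<Longrightarrow> F x y \<le> H x y" and "0 \<le> x" "0 \<le> y"
  shows "next_group F x y \<le> next_group H x y"
  unfolding next_group_def
  by (intro nn_integral_mono assms mult_nonneg_nonneg group_density0_nonneg group_density1_nonneg)
    auto

lemma next_group_mono':
  assumes "\<And>x y. F x y \<le> H x y"
  shows "next_group F x y \<le> next_group H x y"
  unfolding next_group_def using assms by (intro nn_integral_mono) auto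

lemma next_group_add:
  assumes "case_prod F \<in> borel_measurable (borel \<Otimes>\<^sub>M borel)"
    and "case_prod H \<in> borel_measurable (borel \<Otimes>\<^sub>M borel)"
  shows "next_group (\<lambda>x y. F x y + H x y) x y = next_group F x y + next_group H x y"
  unfolding next_group_def
  by (simp add: nn_integral_add measurable_next_group_integrand[OF assms(1)] measurable_next_group_integrand[OF assms(2)])

lemma next_group_cmult:
  assumes "case_prod F \<in> borel_measurable (borel \<Otimes>\<^sub>M borel)"
  shows "next_group (\<lambda>x y. t * F x y) x y = t * next_group F x y"
  unfolding next_group_def
  by (simp add: nn_integral_cmult measurable_next_group_integrand[OF assms])

lemma next_group_SUP:
  assumes "\<And>n. case_prod (F n) \<in> borel_measurable (borel \<Otimes>\<^sub>M borel)"
    and "\<And>x y. incseq (\<lambda>n. F n x y)"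
  shows "next_group (\<lambda>x y. SUP n. F n x y) x y = (SUP n. next_group (F n) x y)"
  unfolding next_group_def
proof -
  have "(\<integral>\<^sup>+w. (SUP n. F n (x * group_density f0 m w) (y * group_density f1 m w)) \<partial>group_measure m) =
     (SUP n. \<integral>\<^sup>+w. F n (x * group_density f0 m w) (y * group_density f1 m w) \<partial>group_measure m)" for m
    using assms(2)
    by (intro nn_integral_monotone_convergence_SUP measurable_next_group_integrand assms(1))
      (auto simp: incseq_def le_fun_def)
  then show "(\<integral>\<^sup>+m. \<integral>\<^sup>+w. (SUP n. F n (x * group_density f0 m w) (y * group_density f1 m w)) \<partial>group_measure m \<partial>p) =
     (SUP n. \<integral>\<^sup>+m. \<integral>\<^sup>+w. F n (x * group_density f0 m w) (y * group_density f1 m w) \<partial>group_measure m \<partial>p)"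
    using assms(2)
    by (simp, intro nn_integral_monotone_convergence_SUP)
      (auto simp: incseq_def le_fun_def intro!: nn_integral_mono)
qed

lemma next_group_density0:
  assumes "0 \<le> x"
  shows "next_group (\<lambda>x y. ennreal x) x y = ennreal x"
  using assms
  by (simp add: next_group_def nn_integral_mult_group_density f0_nonneg f0_integral measure_pmf.emeasure_space_1)

lemma next_group_density1:
  assumes "0 \<le> y"
  shows "next_group (\<lambda>x y. ennreal y) x y = ennreal y"
  using assms
  by (simp add: next_group_def nn_integral_mult_group_density f1_nonneg f1_integral measure_pmf.emeasure_space_1)

lemma sqrt_group_density: "sqrt (group_density f m w) = group_density (\<lambda>x. sqrt (f x)) m w"
  by (induction m) (simp_all add: group_density_def real_sqrt_mult)

section \<open>Hellinger affinity of one observation and of one group\<close>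

definition affinity :: ennreal where
  "affinity = (\<integral>\<^sup>+x. ennreal (sqrt (f0 x * f1 x)) \<partial>M)"

definition group_affinity :: ennreal where
  "group_affinity = (\<integral>\<^sup>+m. affinity ^ m \<partial>p)"

text \<open>Expanding the square of \<open>sqrt f0 - sqrt f1\<close> gives
  \<open>D + 2 * affinity = 2\<close>, where the squared Hellinger distance \<open>D\<close> is
  positive because the densities differ on a set of positive measure. The identity is kept additive
  to avoid subtraction in \<open>ennreal\<close>.\<close>

lemma affinity_less_1: "affinity < 1"
proof -
  define D where "D = (\<integral>\<^sup>+x. ennreal ((sqrt (f0 x) - sqrt (f1 x))\<^sup>2) \<partial>M)"
  have "D \<noteq> 0"
  proof
    assume "D = 0"
    then have "AE x in M. ennreal ((sqrt (f0 x) - sqrt (f1 x))\<^sup>2) = 0"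
      unfolding D_def by (subst (asm) nn_integral_0_iff_AE) auto
    then have "AE x in M. \<not> f0 x \<noteq> f1 x"
      by eventually_elim (simp add: ennreal_eq_0_iff)
    then have "emeasure M {x \<in> space M. f0 x \<noteq> f1 x} = 0"
      by (subst (asm) AE_iff_measurable[OF _ refl]) auto
    with densities_differ show False by simp
  qed
  have "D + 2 * affinity = (\<integral>\<^sup>+x. ennreal ((sqrt (f0 x) - sqrt (f1 x))\<^sup>2) + 2 * ennreal (sqrt (f0 x * f1 x)) \<partial>M)"
    unfolding D_def affinity_def by (simp add: nn_integral_add nn_integral_cmult)
  also have "\<dots> = (\<integral>\<^sup>+x. ennreal (f0 x) + ennreal (f1 x) \<partial>M)"
  proof (rule nn_integral_cong)
    fix x assume "x \<in> space M"
    then have nn: "0 \<le> f0 x" "0 \<le> f1 x"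
      by (auto simp: f0_nonneg f1_nonneg)
    have "2 * ennreal (sqrt (f0 x * f1 x)) = ennreal (2 * sqrt (f0 x * f1 x))"
      using nn by (simp add: ennreal_mult)
    then have "ennreal ((sqrt (f0 x) - sqrt (f1 x))\<^sup>2) + 2 * ennreal (sqrt (f0 x * f1 x)) =
        ennreal ((sqrt (f0 x) - sqrt (f1 x))\<^sup>2 + 2 * sqrt (f0 x * f1 x))"
      using nn by (simp add: ennreal_plus)
    also have "(sqrt (f0 x) - sqrt (f1 x))\<^sup>2 + 2 * sqrt (f0 x * f1 x) = f0 x + f1 x"
      using nn by (simp add: power2_diff real_sqrt_mult)
    finally show "ennreal ((sqrt (f0 x) - sqrt (f1 x))\<^sup>2) + 2 * ennreal (sqrt (f0 x * f1 x)) =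
        ennreal (f0 x) + ennreal (f1 x)"
      using nn by simp
  qed
  also have "\<dots> = 2"
    by (simp add: nn_integral_add f0_integral f1_integral)
  finally have *: "D + 2 * affinity = 2" .
  show ?thesis
  proof (rule ccontr)
    assume "\<not> affinity < 1"
    then have "2 * 1 \<le> 2 * affinity"
      by (intro mult_left_mono) auto
    then have "2 + D \<le> 2 + 0"
      using * by (metis add.commute add.right_neutral add_left_mono mult.right_neutral)
    then have "D \<le> 0"
      by (subst (asm) ennreal_add_left_cancel_le) auto
    with \<open>D \<noteq> 0\<close> show False by simp
  qed
qed

text \<open>Only an empty group carries no information: \<open>r ^ m\<close> is at most
  \<open>r\<close> for \<open>m\<close> at least 1, so the mean is at most
  \<open>(1 - r) * pmf p 0 + r\<close>, which is below 1 because a group is nonempty with positive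
  probability.\<close>

lemma group_affinity_less_1: "group_affinity < 1"
proof -
  obtain r where r: "affinity = ennreal r" "0 \<le> r" "r < 1"
    using affinity_less_1 by (cases affinity) (auto simp: ennreal_less_one_iff)
  have pow: "r ^ m \<le> indicator {0} m * (1 - r) + r" for m
  proof (cases m)
    case (Suc k)
    then show ?thesis using r power_le_one[of r k] by (simp add: mult_left_le)
  qed simp
  have "group_affinity \<le> (\<integral>\<^sup>+m. ennreal (indicator {0} m * (1 - r) + r) \<partial>p)"
    unfolding group_affinity_def r(1)
    by (intro nn_integral_mono) (simp add: ennreal_power r ennreal_leI pow del: ennreal_plus)
  also have "\<dots> = (\<integral>\<^sup>+m. ennreal (1 - r) * indicator {0} m + ennreal r \<partial>p)"
    using r by (intro nn_integral_cong) (auto split: split_indicator simp flip: ennreal_plus)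
  also have "\<dots> = ennreal (1 - r) * ennreal (pmf p 0) + ennreal r"
    by (simp add: nn_integral_add nn_integral_cmult emeasure_pmf_single measure_pmf.emeasure_space_1)
  also have "\<dots> = ennreal ((1 - r) * pmf p 0 + r)"
    using r by (simp add: ennreal_mult)
  also have "\<dots> < 1"
  proof -
    have "(1 - r) * pmf p 0 < (1 - r) * 1"
      using r group_nontrivial by (intro mult_strict_left_mono) auto
    then have "(1 - r) * pmf p 0 + r < (1 - r) * 1 + r"
      by (rule add_strict_right_mono)
    also have "\<dots> = 1" by simp
    finally show ?thesis
      by (simp only: ennreal_less_one_iff)
  qed
  finally show ?thesis .
qed

text \<open>Roots of products factor over the observations, so \<open>sqrt (x * y)\<close> is an
  eigenfunction of \<open>next_group\<close>. This yields geometric decay for the termination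
  argument and for the bounds on the risk.\<close>

lemma next_group_sqrt:
  assumes "0 \<le> x" "0 \<le> y"
  shows "next_group (\<lambda>x y. ennreal (sqrt (x * y))) x y = group_affinity * ennreal (sqrt (x * y))"
proof -
  have "(\<integral>\<^sup>+w. ennreal (sqrt (x * group_density f0 m w * (y * group_density f1 m w))) \<partial>group_measure m) =
      ennreal (sqrt (x * y)) * affinity ^ m" for m
  proof -
    have "ennreal (sqrt (x * group_density f0 m w * (y * group_density f1 m w))) =
        ennreal (sqrt (x * y)) * ennreal (group_density (\<lambda>x. sqrt (f0 x * f1 x)) m w)" for w
    proof -
      have "sqrt (x * group_density f0 m w * (y * group_density f1 m w)) =
          sqrt (x * y) * group_density (\<lambda>x. sqrt (f0 x * f1 x)) m w"
        by (simp add: real_sqrt_mult sqrt_group_density, simp add: group_density_def prod.distrib mult_ac)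
      then show ?thesis using assms by (simp add: ennreal_mult')
    qed
    then have "(\<integral>\<^sup>+w. ennreal (sqrt (x * group_density f0 m w * (y * group_density f1 m w))) \<partial>group_measure m) =
        ennreal (sqrt (x * y)) * (\<integral>\<^sup>+w. ennreal (group_density (\<lambda>x. sqrt (f0 x * f1 x)) m w) \<partial>group_measure m)"
      by (simp add: nn_integral_cmult)
    also have "(\<integral>\<^sup>+w. ennreal (group_density (\<lambda>x. sqrt (f0 x * f1 x)) m w) \<partial>group_measure m) = affinity ^ m"
      unfolding affinity_def by (rule nn_integral_group_density) (auto simp: f0_nonneg f1_nonneg)
    finally show ?thesis .
  qed
  then show ?thesis
    by (simp add: next_group_def group_affinity_def nn_integral_cmult mult.commute)
qed

section \<open>Value iteration and its limit\<close>

definition bellman :: "ennreal \<Rightarrow> ennreal \<Rightarrow> ennreal \<Rightarrow> ennreal \<Rightarrow> (real \<Rightarrow> real \<Rightarrow> ennreal) \<Rightarrow> real \<Rightarrow> real \<Rightarrow> ennreal"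
  where "bellman a0 a1 l0 l1 F x y =
    min (min (l0 * ennreal x) (l1 * ennreal y)) (a0 * ennreal x + a1 * ennreal y + next_group F x y)"

text \<open>Starting from 0 makes the iterates increase, so the limit exists in
  \<open>[0, \<infinity>]\<close> before anything is known about finiteness, and monotone
  convergence applies.\<close>

primrec risk_iter :: "ennreal \<Rightarrow> ennreal \<Rightarrow> ennreal \<Rightarrow> ennreal \<Rightarrow> nat \<Rightarrow> real \<Rightarrow> real \<Rightarrow> ennreal" where
  "risk_iter a0 a1 l0 l1 0 = (\<lambda>x y. 0)"
| "risk_iter a0 a1 l0 l1 (Suc n) = bellman a0 a1 l0 l1 (risk_iter a0 a1 l0 l1 n)"

definition risk :: "ennreal \<Rightarrow> ennreal \<Rightarrow> ennreal \<Rightarrow> ennreal \<Rightarrow> real \<Rightarrow> real \<Rightarrow> ennreal" where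
  "risk a0 a1 l0 l1 x y = (SUP n. risk_iter a0 a1 l0 l1 n x y)"

definition continuation_risk :: "ennreal \<Rightarrow> ennreal \<Rightarrow> ennreal \<Rightarrow> ennreal \<Rightarrow> real \<Rightarrow> real \<Rightarrow> ennreal" where
  "continuation_risk a0 a1 l0 l1 x y =
     a0 * ennreal x + a1 * ennreal y + next_group (risk a0 a1 l0 l1) x y"

lemma measurable_risk_iter: "case_prod (risk_iter a0 a1 l0 l1 n) \<in> borel_measurable (borel \<Otimes>\<^sub>M borel)"
proof (induction n)
  case (Suc n)
  note [measurable] = measurable_next_group[OF Suc, unfolded case_prod_unfold]
  show ?case by (simp add: bellman_def case_prod_unfold)
qed simp

lemma measurable_risk: "case_prod (risk a0 a1 l0 l1) \<in> borel_measurable (borel \<Otimes>\<^sub>M borel)"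
  using measurable_risk_iter[of a0 a1 l0 l1]
  by (simp add: risk_def[abs_def] case_prod_unfold)

lemma bellman_mono:
  assumes "\<And>x y. F x y \<le> H x y" "l0 \<le> l0'" "l1 \<le> l1'"
  shows "bellman a0 a1 l0 l1 F x y \<le> bellman a0 a1 l0' l1' H x y"
  unfolding bellman_def
  by (intro min.mono add_left_mono mult_right_mono assms next_group_mono') auto

lemma incseq_risk_iter: "incseq (\<lambda>n. risk_iter a0 a1 l0 l1 n x y)"
proof (rule incseq_SucI)
  fix n show "risk_iter a0 a1 l0 l1 n x y \<le> risk_iter a0 a1 l0 l1 (Suc n) x y"
  proof (induction n arbitrary: x y)
    case (Suc n)
    have "bellman a0 a1 l0 l1 (risk_iter a0 a1 l0 l1 n) x y \<le> bellman a0 a1 l0 l1 (risk_iter a0 a1 l0 l1 (Suc n)) x y"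
      by (rule bellman_mono[OF Suc]) auto
    then show ?case by simp
  qed simp
qed

lemma risk_mono:
  assumes "l0 \<le> l0'" "l1 \<le> l1'"
  shows "risk a0 a1 l0 l1 x y \<le> risk a0 a1 l0' l1' x y"
proof -
  have "risk_iter a0 a1 l0 l1 n x y \<le> risk_iter a0 a1 l0' l1' n x y" for n x y
    by (induction n arbitrary: x y) (auto intro!: bellman_mono assms)
  then show ?thesis
    unfolding risk_def by (intro SUP_mono) auto
qed

lemma continuation_risk_mono:
  assumes "l0 \<le> l0'" "l1 \<le> l1'"
  shows "continuation_risk a0 a1 l0 l1 x y \<le> continuation_risk a0 a1 l0' l1' x y"
  unfolding continuation_risk_def by (intro add_left_mono next_group_mono' risk_mono assms)

lemma continuation_risk_eq_SUP:
  "continuation_risk a0 a1 l0 l1 x y =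
     (SUP n. a0 * ennreal x + a1 * ennreal y + next_group (risk_iter a0 a1 l0 l1 n) x y)"
  unfolding continuation_risk_def risk_def[abs_def]
  by (subst next_group_SUP[OF measurable_risk_iter incseq_risk_iter])
    (simp add: ennreal_SUP_add_right)

text \<open>The limit passes through \<open>next_group\<close> by monotone convergence and through
  \<open>min\<close> because meets distribute over arbitrary suprema in
  \<open>ennreal\<close>.\<close>

lemma risk_eq:
  "risk a0 a1 l0 l1 x y = min (min (l0 * ennreal x) (l1 * ennreal y)) (continuation_risk a0 a1 l0 l1 x y)"
proof (rule antisym)
  have "risk_iter a0 a1 l0 l1 n x y \<le> min (min (l0 * ennreal x) (l1 * ennreal y)) (continuation_risk a0 a1 l0 l1 x y)" for n
  proof (cases n)
    case (Suc k)
    have "next_group (risk_iter a0 a1 l0 l1 k) x y \<le> next_group (risk a0 a1 l0 l1) x y"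
      by (rule next_group_mono') (auto simp: risk_def intro: SUP_upper)
    then show ?thesis
      unfolding Suc risk_iter.simps bellman_def continuation_risk_def
      by (intro min.mono add_left_mono) auto
  qed simp
  then show "risk a0 a1 l0 l1 x y \<le> min (min (l0 * ennreal x) (l1 * ennreal y)) (continuation_risk a0 a1 l0 l1 x y)"
    unfolding risk_def by (rule SUP_least)
next
  have "min s (SUP n. c n) \<le> (SUP n. min s (c n))" for s :: ennreal and c :: "nat \<Rightarrow> ennreal"
    by (simp add: inf_SUP flip: inf_min)
  from this[of "min (l0 * ennreal x) (l1 * ennreal y)"
    "\<lambda>n. a0 * ennreal x + a1 * ennreal y + next_group (risk_iter a0 a1 l0 l1 n) x y"]
  have "min (min (l0 * ennreal x) (l1 * ennreal y)) (continuation_risk a0 a1 l0 l1 x y)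
      \<le> (SUP n. risk_iter a0 a1 l0 l1 (Suc n) x y)"
    by (simp add: bellman_def flip: continuation_risk_eq_SUP)
  also have "\<dots> \<le> risk a0 a1 l0 l1 x y"
    unfolding risk_def by (rule SUP_least) (rule SUP_upper, simp)
  finally show "min (min (l0 * ennreal x) (l1 * ennreal y)) (continuation_risk a0 a1 l0 l1 x y) \<le> risk a0 a1 l0 l1 x y" .
qed

lemma risk_le:
  "risk a0 a1 l0 l1 x y \<le> l0 * ennreal x"
  "risk a0 a1 l0 l1 x y \<le> l1 * ennreal y"
  "risk a0 a1 l0 l1 x y \<le> continuation_risk a0 a1 l0 l1 x y"
  unfolding risk_eq by (auto intro: min.coboundedI1)

section \<open>Concavity on the quadrant as superadditivity and homogeneity\<close>

definition superadditive :: "(real \<Rightarrow> real \<Rightarrow> ennreal) \<Rightarrow> bool" where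
  "superadditive F \<longleftrightarrow> (\<forall>x\<ge>0. \<forall>y\<ge>0. \<forall>x'\<ge>0. \<forall>y'\<ge>0. F x y + F x' y' \<le> F (x + x') (y + y'))"

definition homogeneous :: "(real \<Rightarrow> real \<Rightarrow> ennreal) \<Rightarrow> bool" where
  "homogeneous F \<longleftrightarrow> (\<forall>t\<ge>0. \<forall>x\<ge>0. \<forall>y\<ge>0. F (t * x) (t * y) = ennreal t * F x y)"

lemma superadditive_next_group:
  assumes "superadditive F" and meas: "case_prod F \<in> borel_measurable (borel \<Otimes>\<^sub>M borel)"
  shows "superadditive (next_group F)"
  unfolding superadditive_def
proof (intro allI impI)
  fix x y x' y' :: real assume nn: "0 \<le> x" "0 \<le> y" "0 \<le> x'" "0 \<le> y'"
  have "next_group F x y + next_group F x' y' =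
      (\<integral>\<^sup>+m. \<integral>\<^sup>+w. F (x * group_density f0 m w) (y * group_density f1 m w) +
        F (x' * group_density f0 m w) (y' * group_density f1 m w) \<partial>group_measure m \<partial>p)"
    unfolding next_group_def by (simp add: nn_integral_add measurable_next_group_integrand[OF meas])
  also have "\<dots> \<le> next_group F (x + x') (y + y')"
    unfolding next_group_def
  proof (intro nn_integral_mono)
    fix m w assume "w \<in> space (group_measure m)"
    then have "0 \<le> group_density f0 m w" "0 \<le> group_density f1 m w"
      by (auto intro: group_density0_nonneg group_density1_nonneg)
    with nn assms(1) show "F (x * group_density f0 m w) (y * group_density f1 m w) +
        F (x' * group_density f0 m w) (y' * group_density f1 m w) \<le>
        F ((x + x') * group_density f0 m w) ((y + y') * group_density f1 m w)"
      by (simp add: superadditive_def distrib_right)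
  qed
  finally show "next_group F x y + next_group F x' y' \<le> next_group F (x + x') (y + y')" .
qed

lemma homogeneous_next_group:
  assumes "homogeneous F" and meas: "case_prod F \<in> borel_measurable (borel \<Otimes>\<^sub>M borel)"
  shows "homogeneous (next_group F)"
  unfolding homogeneous_def
proof (intro allI impI)
  fix t x y :: real assume nn: "0 \<le> t" "0 \<le> x" "0 \<le> y"
  have "F (t * x * group_density f0 m w) (t * y * group_density f1 m w) =
      ennreal t * F (x * group_density f0 m w) (y * group_density f1 m w)"
    if "w \<in> space (group_measure m)" for m w
    using assms(1) nn group_density0_nonneg[OF that] group_density1_nonneg[OF that]
    by (simp add: homogeneous_def mult.assoc)
  then have "next_group F (t * x) (t * y) =
      (\<integral>\<^sup>+m. \<integral>\<^sup>+w. ennreal t * F (x * group_density f0 m w) (y * group_density f1 m w) \<partial>group_measure m \<partial>p)"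
    unfolding next_group_def by (intro nn_integral_cong) auto
  then show "next_group F (t * x) (t * y) = ennreal t * next_group F x y"
    by (simp add: next_group_def nn_integral_cmult measurable_next_group_integrand[OF meas])
qed

lemma superadditive_linear_plus:
  assumes "superadditive F"
  shows "superadditive (\<lambda>x y. a0 * ennreal x + a1 * ennreal y + F x y)"
  unfolding superadditive_def
proof (intro allI impI)
  fix x y x' y' :: real assume nn: "0 \<le> x" "0 \<le> y" "0 \<le> x'" "0 \<le> y'"
  have "a0 * ennreal x + a1 * ennreal y + F x y + (a0 * ennreal x' + a1 * ennreal y' + F x' y') =
      a0 * ennreal (x + x') + a1 * ennreal (y + y') + (F x y + F x' y')"
    using nn by (simp add: algebra_simps)
  also have "\<dots> \<le> a0 * ennreal (x + x') + a1 * ennreal (y + y') + F (x + x') (y + y')"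
    using assms nn by (intro add_left_mono) (auto simp: superadditive_def)
  finally show "a0 * ennreal x + a1 * ennreal y + F x y + (a0 * ennreal x' + a1 * ennreal y' + F x' y') \<le>
      a0 * ennreal (x + x') + a1 * ennreal (y + y') + F (x + x') (y + y')" .
qed

lemma homogeneous_linear_plus:
  assumes "homogeneous F"
  shows "homogeneous (\<lambda>x y. a0 * ennreal x + a1 * ennreal y + F x y)"
  using assms by (auto simp: homogeneous_def ennreal_mult distrib_left mult_ac)

text \<open>Both summands on the left are at most their \<open>F\<close> values and also at most
  their \<open>H\<close> values, so their sum is below each of the two superadditive bounds.\<close>

lemma superadditive_min:
  assumes "superadditive F" "superadditive H"
  shows "superadditive (\<lambda>x y. min (F x y) (H x y))"
  using assms unfolding superadditive_def
  by (auto intro: order_trans[OF add_mono] min.cobounded1 min.cobounded2)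

lemma homogeneous_min:
  assumes "homogeneous F" "homogeneous H"
  shows "homogeneous (\<lambda>x y. min (F x y) (H x y))"
proof -
  have "min (t * a) (t * b) = t * min a b" for t a b :: ennreal
    by (metis min_def mult_left_mono order_antisym nle_le zero_le)
  then show ?thesis
    using assms by (simp add: homogeneous_def)
qed

lemma superadditive_homogeneous_risk_iter:
  "superadditive (risk_iter a0 a1 l0 l1 n) \<and> homogeneous (risk_iter a0 a1 l0 l1 n)"
proof (induction n)
  case 0
  then show ?case by (simp add: superadditive_def homogeneous_def)
next
  case (Suc n)
  have "superadditive (\<lambda>x y. l0 * ennreal x)" "superadditive (\<lambda>x y. l1 * ennreal y)"
    by (auto simp: superadditive_def distrib_left)
  moreover have "homogeneous (\<lambda>x y. l0 * ennreal x)" "homogeneous (\<lambda>x y. l1 * ennreal y)"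
    by (auto simp: homogeneous_def ennreal_mult mult_ac)
  ultimately show ?case
    using Suc unfolding risk_iter.simps bellman_def[abs_def]
    by (intro conjI superadditive_min homogeneous_min superadditive_linear_plus homogeneous_linear_plus
        superadditive_next_group homogeneous_next_group measurable_risk_iter) auto
qed

text \<open>Every iterate is superadditive, and for increasing sequences the supremum of the sums is
  the sum of the suprema, so the property survives in the limit.\<close>

lemma superadditive_continuation_risk: "superadditive (continuation_risk a0 a1 l0 l1)"
proof -
  have "superadditive (risk a0 a1 l0 l1)"
    unfolding superadditive_def
  proof (intro allI impI)
    fix x y x' y' :: real assume nn: "0 \<le> x" "0 \<le> y" "0 \<le> x'" "0 \<le> y'"
    have "risk a0 a1 l0 l1 x y + risk a0 a1 l0 l1 x' y' =
        (SUP n. risk_iter a0 a1 l0 l1 n x y + risk_iter a0 a1 l0 l1 n x' y')"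
      unfolding risk_def by (rule ennreal_SUP_add[symmetric]) (auto intro: incseq_risk_iter)
    also have "\<dots> \<le> risk a0 a1 l0 l1 (x + x') (y + y')"
      unfolding risk_def using superadditive_homogeneous_risk_iter nn
      by (intro SUP_subset_mono) (auto simp: superadditive_def)
    finally show "risk a0 a1 l0 l1 x y + risk a0 a1 l0 l1 x' y' \<le> risk a0 a1 l0 l1 (x + x') (y + y')" .
  qed
  then show ?thesis
    unfolding continuation_risk_def[abs_def]
    by (intro superadditive_linear_plus superadditive_next_group measurable_risk)
qed

lemma homogeneous_continuation_risk: "homogeneous (continuation_risk a0 a1 l0 l1)"
proof -
  have "homogeneous (risk a0 a1 l0 l1)"
    using superadditive_homogeneous_risk_iter
    by (auto simp: homogeneous_def risk_def SUP_mult_left_ennreal)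
  then show ?thesis
    unfolding continuation_risk_def[abs_def]
    by (intro homogeneous_linear_plus homogeneous_next_group measurable_risk)
qed

section \<open>Bounds from fixed sample sizes and the choice of the losses\<close>

lemma next_group_linear:
  assumes "0 \<le> x" "0 \<le> y"
  shows "next_group (\<lambda>x y. a0 * ennreal x + a1 * ennreal y) x y = a0 * ennreal x + a1 * ennreal y"
proof -
  have [measurable]: "(\<lambda>(x, y). ennreal x) \<in> borel_measurable (borel \<Otimes>\<^sub>M borel)"
    "(\<lambda>(x, y). ennreal y) \<in> borel_measurable (borel \<Otimes>\<^sub>M borel)"
    by measurable
  show ?thesis
    using assms by (subst next_group_add, measurable) (simp add: next_group_cmult next_group_density0 next_group_density1)
qed

text \<open>One more group leaves the linear part unchanged, adds one more copy of it as the price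
  of that group, and multiplies the root by \<open>group_affinity\<close>.\<close>

lemma continuation_risk_le_fixed_size_step:
  assumes "\<And>x y. 0 \<le> x \<Longrightarrow> 0 \<le> y \<Longrightarrow> risk a0 a1 l0 l1 x y \<le>
      of_nat k * (a0 * ennreal x + a1 * ennreal y) + L * group_affinity ^ k * ennreal (sqrt (x * y))"
    and "0 \<le> x" "0 \<le> y"
  shows "continuation_risk a0 a1 l0 l1 x y \<le>
    of_nat (Suc k) * (a0 * ennreal x + a1 * ennreal y) + L * group_affinity ^ Suc k * ennreal (sqrt (x * y))"
proof -
  let ?lin = "\<lambda>x y. a0 * ennreal x + a1 * ennreal y"
  let ?bd = "\<lambda>x y. of_nat k * ?lin x y + L * group_affinity ^ k * ennreal (sqrt (x * y))"
  have m1: "case_prod (\<lambda>x y. of_nat k * ?lin x y) \<in> borel_measurable (borel \<Otimes>\<^sub>M borel)"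
    and m1': "case_prod ?lin \<in> borel_measurable (borel \<Otimes>\<^sub>M borel)"
    and m2: "case_prod (\<lambda>x y. L * group_affinity ^ k * ennreal (sqrt (x * y))) \<in> borel_measurable (borel \<Otimes>\<^sub>M borel)"
    and m2': "case_prod (\<lambda>x y. ennreal (sqrt (x * y))) \<in> borel_measurable (borel \<Otimes>\<^sub>M borel)"
    by (auto simp: case_prod_unfold)
  have "continuation_risk a0 a1 l0 l1 x y \<le> ?lin x y + next_group ?bd x y"
    unfolding continuation_risk_def by (intro add_left_mono next_group_mono assms)
  also have "next_group ?bd x y = of_nat k * ?lin x y + L * group_affinity ^ k * (group_affinity * ennreal (sqrt (x * y)))"
    by (simp only: next_group_add[OF m1 m2] next_group_cmult[OF m1'] next_group_cmult[OF m2']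
        next_group_linear[OF assms(2,3)] next_group_sqrt[OF assms(2,3)])
  finally show ?thesis
    by (simp add: distrib_right mult_ac add_ac)
qed

text \<open>
  The cost of the strategy that takes \<open>k\<close> groups whatever they are; the last term bounds
  the Bayes risk of deciding after them, by \<open>min u v \<le> sqrt (u * v)\<close>.
\<close>

lemma risk_le_fixed_size:
  assumes "0 \<le> x" "0 \<le> y"
  shows "risk a0 a1 L L x y \<le>
    of_nat k * (a0 * ennreal x + a1 * ennreal y) + L * group_affinity ^ k * ennreal (sqrt (x * y))"
  using assms
proof (induction k arbitrary: x y)
  case 0
  have "ennreal (min x y) \<le> ennreal (sqrt (x * y))"
  proof (rule ennreal_leI, rule real_le_rsqrt)
    show "(min x y)\<^sup>2 \<le> x * y"
      using 0 unfolding power2_eq_square by (intro mult_mono) auto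
  qed
  moreover have "risk a0 a1 L L x y \<le> L * ennreal (min x y)"
    using risk_le(1,2)[of a0 a1 L L x y] by (auto simp: min_def)
  ultimately show ?case
    by (simp add: order_trans[OF _ mult_left_mono])
next
  case (Suc k)
  then show ?case
    by (blast intro: order_trans[OF risk_le(3) continuation_risk_le_fixed_size_step])
qed

lemma ennreal_divide_mult_cancel: "0 < A \<Longrightarrow> t / ennreal A * ennreal A = t"
  by (simp add: ennreal_divide_times ennreal_mult_divide_eq)

text \<open>
  The stopping costs are the least fixed point of the monotone map that sends them to the
  continuation risks at the boundary; sufficiently large equal costs are mapped below themselves.
\<close>

lemma stopping_costs_exist:
  assumes "0 < A" "0 < B" and a: "a0 \<noteq> \<infinity>" "a1 \<noteq> \<infinity>"
  obtains l0 l1 where "l0 \<noteq> \<infinity>" "l1 \<noteq> \<infinity>"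
    "continuation_risk a0 a1 l0 l1 1 B = l0"
    "continuation_risk a0 a1 l0 l1 1 A = l1 * ennreal A"
proof -
  define T where "T = (\<lambda>l. (continuation_risk a0 a1 (fst l) (snd l) 1 B,
    continuation_risk a0 a1 (fst l) (snd l) 1 A / ennreal A))"
  have T: "T l = (continuation_risk a0 a1 (fst l) (snd l) 1 B,
    continuation_risk a0 a1 (fst l) (snd l) 1 A / ennreal A)" for l
    by (simp add: T_def)
  have "mono T"
    unfolding T_def
    by (intro monoI) (auto simp: less_eq_prod_def intro!: continuation_risk_mono divide_right_mono_ennreal)
  obtain r where r: "group_affinity = ennreal r" "0 \<le> r" "r < 1"
    using group_affinity_less_1 by (cases group_affinity) (auto simp: ennreal_less_one_iff)
  \<comment> \<open>With \<open>r ^ Suc k\<close> below this bound, the affinity term is at most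
    \<open>L / 2\<close> at \<open>(1, B)\<close> and at most \<open>L * A / 2\<close> at
    \<open>(1, A)\<close>: half of what the fixed point inequality allows.\<close>
  define \<epsilon> where "\<epsilon> = min (1 / (2 * sqrt B)) (A / (2 * sqrt A))"
  have "0 < \<epsilon>" using assms by (simp add: \<epsilon>_def)
  then obtain k where "r ^ k < \<epsilon>"
    using r real_arch_pow_inv[of \<epsilon> r] by auto
  moreover have "r ^ Suc k \<le> r ^ k"
    using r by (simp add: mult_left_le_one_le)
  ultimately have k: "r ^ Suc k < \<epsilon>" by linarith
  have kB: "r ^ Suc k * sqrt B \<le> 1 / 2"
  proof -
    have "r ^ Suc k * sqrt B \<le> 1 / (2 * sqrt B) * sqrt B"
      using k assms by (intro mult_right_mono) (auto simp: \<epsilon>_def)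
    then show ?thesis using assms by simp
  qed
  have kA: "r ^ Suc k * sqrt A \<le> A / 2"
  proof -
    have "r ^ Suc k * sqrt A \<le> A / (2 * sqrt A) * sqrt A"
      using k assms by (intro mult_right_mono) (auto simp: \<epsilon>_def)
    then show ?thesis using assms by simp
  qed
  define cB where "cB = of_nat (Suc k) * (a0 * ennreal 1 + a1 * ennreal B)"
  define cA where "cA = of_nat (Suc k) * (a0 * ennreal 1 + a1 * ennreal A)"
  have fin: "cA < \<infinity>" "cB < \<infinity>"
    using a by (auto simp: cA_def cB_def ennreal_mult_less_top less_top of_nat_less_top)
  obtain bA bB where b: "cA = ennreal bA" "0 \<le> bA" "cB = ennreal bB" "0 \<le> bB"
    using fin by (cases cA; cases cB) auto
  \<comment> \<open>Large enough for both \<open>bB + L / 2 \<le> L\<close> and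
    \<open>bA + L * A / 2 \<le> L * A\<close>, where \<open>bB\<close> and \<open>bA\<close> are the
    sampling costs of \<open>Suc k\<close> groups at the two boundary points.\<close>
  define L where "L = 2 * (bB + bA / A)"
  have L: "0 \<le> L" using b assms by (simp add: L_def)
  have "continuation_risk a0 a1 (ennreal L) (ennreal L) 1 B \<le>
      cB + ennreal L * group_affinity ^ Suc k * ennreal (sqrt (1 * B))"
    unfolding cB_def using assms
    by (intro continuation_risk_le_fixed_size_step risk_le_fixed_size) auto
  also have "\<dots> = ennreal (bB + L * (r ^ Suc k * sqrt B))"
    using b L r assms by (simp add: ennreal_power ennreal_mult mult.assoc del: power_Suc)
  also have "\<dots> \<le> ennreal L"
  proof (rule ennreal_leI)
    have "L * (r ^ Suc k * sqrt B) \<le> L * (1 / 2)"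
      by (rule mult_left_mono[OF kB L])
    moreover have "0 \<le> bA / A" using b assms by simp
    ultimately show "bB + L * (r ^ Suc k * sqrt B) \<le> L" by (simp add: L_def)
  qed
  finally have B: "continuation_risk a0 a1 (ennreal L) (ennreal L) 1 B \<le> ennreal L" .
  have "continuation_risk a0 a1 (ennreal L) (ennreal L) 1 A \<le>
      cA + ennreal L * group_affinity ^ Suc k * ennreal (sqrt (1 * A))"
    unfolding cA_def using assms
    by (intro continuation_risk_le_fixed_size_step risk_le_fixed_size) auto
  also have "\<dots> = ennreal (bA + L * (r ^ Suc k * sqrt A))"
    using b L r assms by (simp add: ennreal_power ennreal_mult mult.assoc del: power_Suc)
  also have "\<dots> \<le> ennreal (L * A)"
  proof (rule ennreal_leI)
    have "L * (r ^ Suc k * sqrt A) \<le> L * (A / 2)"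
      by (rule mult_left_mono[OF kA L])
    moreover have "0 \<le> bB * A" using b assms by simp
    moreover have "L * A = 2 * (bB * A) + 2 * bA" using assms by (simp add: L_def field_simps)
    ultimately show "bA + L * (r ^ Suc k * sqrt A) \<le> L * A" by simp
  qed
  finally have A: "continuation_risk a0 a1 (ennreal L) (ennreal L) 1 A / ennreal A \<le> ennreal (L * A) / ennreal A"
    by (rule divide_right_mono_ennreal)
  also have "\<dots> = ennreal L"
    using assms L by (simp add: divide_ennreal)
  finally have "T (ennreal L, ennreal L) \<le> (ennreal L, ennreal L)"
    using B by (simp add: T)
  then have below: "lfp T \<le> (ennreal L, ennreal L)"
    by (rule lfp_lowerbound)
  have fixed: "T (lfp T) = lfp T"
    using lfp_unfold[OF \<open>mono T\<close>] by simp
  show ?thesis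
  proof (rule that[of "fst (lfp T)" "snd (lfp T)"])
    show "fst (lfp T) \<noteq> \<infinity>" "snd (lfp T) \<noteq> \<infinity>"
      using below by (auto simp: less_eq_prod_def top_unique)
    show "continuation_risk a0 a1 (fst (lfp T)) (snd (lfp T)) 1 B = fst (lfp T)"
      using arg_cong[OF fixed, of fst] by (subst (asm) T) simp
    have "continuation_risk a0 a1 (fst (lfp T)) (snd (lfp T)) 1 A / ennreal A = snd (lfp T)"
      using arg_cong[OF fixed, of snd] by (subst (asm) T) simp
    then show "continuation_risk a0 a1 (fst (lfp T)) (snd (lfp T)) 1 A = snd (lfp T) * ennreal A"
      using ennreal_divide_mult_cancel[OF assms(1)] by metis
  qed
qed

section \<open>Stopping and continuation regions cut out by the two boundary rays\<close>

context
  fixes a0 a1 l0 l1 :: ennreal and A B :: real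
  assumes A: "0 < A" and AB: "A < B"
    and at_B: "continuation_risk a0 a1 l0 l1 1 B = l0"
    and at_A: "continuation_risk a0 a1 l0 l1 1 A = l1 * ennreal A"
begin

text \<open>Homogeneity carries the two boundary values along whole rays: on slope \<open>B\<close>
  continuing is exactly as good as rejecting, on slope \<open>A\<close> exactly as good as
  accepting.\<close>

lemma continuation_risk_ray:
  assumes "0 \<le> t"
  shows "continuation_risk a0 a1 l0 l1 t (t * B) = l0 * ennreal t"
    and "continuation_risk a0 a1 l0 l1 t (t * A) = l1 * ennreal (t * A)"
proof -
  have "continuation_risk a0 a1 l0 l1 (t * 1) (t * y) = ennreal t * continuation_risk a0 a1 l0 l1 1 y" if "0 \<le> y" for y
    using homogeneous_continuation_risk[of a0 a1 l0 l1] assms that unfolding homogeneous_def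
    by (metis zero_le_one)
  from this[of B] this[of A] show "continuation_risk a0 a1 l0 l1 t (t * B) = l0 * ennreal t"
    "continuation_risk a0 a1 l0 l1 t (t * A) = l1 * ennreal (t * A)"
    using assms A AB by (simp_all add: at_A at_B mult_ac ennreal_mult)
qed

text \<open>Superadditivity applied to \<open>(x, y)\<close> and the nonnegative increment; the risk
  of the increment is dropped.\<close>

lemma continuation_risk_add_mono:
  assumes "0 \<le> x" "0 \<le> y" "x \<le> x'" "y \<le> y'"
  shows "continuation_risk a0 a1 l0 l1 x y \<le> continuation_risk a0 a1 l0 l1 x' y'"
proof -
  have "continuation_risk a0 a1 l0 l1 x y + continuation_risk a0 a1 l0 l1 (x' - x) (y' - y) \<le>
      continuation_risk a0 a1 l0 l1 (x + (x' - x)) (y + (y' - y))"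
    using superadditive_continuation_risk[of a0 a1 l0 l1] assms
    unfolding superadditive_def by (meson diff_ge_0_iff_ge)
  then show ?thesis
    by simp (metis add.commute add_increasing2 order_trans le_iff_add)
qed

text \<open>Moving \<open>(x, y)\<close> left to \<open>(y / A, y)\<close> on the lower ray does not
  raise \<open>h\<close>, whose value there is \<open>l1 y\<close>, so accepting is no worse than
  continuing. Moving up from \<open>(x, x * A)\<close> to \<open>(x, x * B)\<close> compares the two
  rays and shows that accepting is no worse than rejecting.\<close>

lemma risk_accept:
  assumes "0 \<le> x" "0 \<le> y" "y \<le> A * x"
  shows "risk a0 a1 l0 l1 x y = l1 * ennreal y"
proof -
  have "y / A \<le> x" using assms A by (simp add: field_simps)
  then have "continuation_risk a0 a1 l0 l1 (y / A) (y / A * A) \<le> continuation_risk a0 a1 l0 l1 x y"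
    using assms A by (intro continuation_risk_add_mono) auto
  then have 1: "l1 * ennreal y \<le> continuation_risk a0 a1 l0 l1 x y"
    using continuation_risk_ray(2)[of "y / A"] assms A by simp
  have "continuation_risk a0 a1 l0 l1 x (x * A) \<le> continuation_risk a0 a1 l0 l1 x (x * B)"
    using assms A AB by (intro continuation_risk_add_mono) (auto intro: mult_left_mono)
  then have "l1 * ennreal (x * A) \<le> l0 * ennreal x"
    using continuation_risk_ray assms by simp
  moreover have "l1 * ennreal y \<le> l1 * ennreal (x * A)"
    using assms by (intro mult_left_mono ennreal_leI) (auto simp: mult.commute)
  ultimately have "l1 * ennreal y \<le> l0 * ennreal x" by simp
  with 1 show ?thesis by (simp add: risk_eq min_def)
qed

text \<open>Moving down to \<open>(x, x * B)\<close> on the upper ray compares rejecting with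
  continuing; moving right from there to the lower ray, at height \<open>x * B\<close>, compares
  rejecting with accepting.\<close>

lemma risk_reject:
  assumes "0 \<le> x" "0 \<le> y" "B * x \<le> y"
  shows "risk a0 a1 l0 l1 x y = l0 * ennreal x"
proof -
  have "continuation_risk a0 a1 l0 l1 x (x * B) \<le> continuation_risk a0 a1 l0 l1 x y"
    using assms A AB by (intro continuation_risk_add_mono) (auto simp: mult.commute)
  then have 1: "l0 * ennreal x \<le> continuation_risk a0 a1 l0 l1 x y"
    using continuation_risk_ray(1)[of x] assms by simp
  have "continuation_risk a0 a1 l0 l1 x (x * B) \<le> continuation_risk a0 a1 l0 l1 (x * B / A) (x * B / A * A)"
  proof -
    have "x * A \<le> x * B" using assms AB by (intro mult_left_mono) auto
    then show ?thesis
      using assms A AB by (intro continuation_risk_add_mono) (auto simp: field_simps)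
  qed
  then have "l0 * ennreal x \<le> l1 * ennreal (x * B)"
    using continuation_risk_ray(1)[of x] continuation_risk_ray(2)[of "x * B / A"] assms A AB by simp
  moreover have "l1 * ennreal (x * B) \<le> l1 * ennreal y"
    using assms by (intro mult_left_mono ennreal_leI) (auto simp: mult.commute)
  ultimately have "l0 * ennreal x \<le> l1 * ennreal y" by simp
  with 1 show ?thesis by (simp add: risk_eq min_def)
qed

text \<open>Moving right reaches the lower ray and moving up reaches the upper ray, and neither move
  lowers \<open>h\<close>. All three regions are closed, so on the boundary rays stopping and
  continuing are equally good; this is what leaves the stopping rule free when the ratio equals
  \<open>A\<close> or \<open>B\<close>.\<close>

lemma risk_continue:
  assumes "0 \<le> x" "0 \<le> y" "A * x \<le> y" "y \<le> B * x"
  shows "risk a0 a1 l0 l1 x y = continuation_risk a0 a1 l0 l1 x y"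
proof -
  have "continuation_risk a0 a1 l0 l1 x y \<le> continuation_risk a0 a1 l0 l1 (y / A) (y / A * A)"
    using assms A by (intro continuation_risk_add_mono) (auto simp: field_simps)
  then have "continuation_risk a0 a1 l0 l1 x y \<le> l1 * ennreal y"
    using continuation_risk_ray(2)[of "y / A"] assms A by simp
  moreover have "continuation_risk a0 a1 l0 l1 x y \<le> continuation_risk a0 a1 l0 l1 x (x * B)"
    using assms A by (intro continuation_risk_add_mono) (auto simp: mult.commute)
  then have "continuation_risk a0 a1 l0 l1 x y \<le> l0 * ennreal x"
    using continuation_risk_ray(1)[of x] assms by simp
  ultimately show ?thesis by (simp add: risk_eq min_absorb2)
qed

end

end

section \<open>Stopping rules and the stagewise recursion\<close>

text \<open>In contrast to \<open>continue_prob\<close> the product includes the decision after the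
  last observed group. It is 1 for the empty vector, so the recursion can start before the first
  group.\<close>

definition continued :: "'a rule \<Rightarrow> 'a rule" where
  "continued \<psi> n x = (\<Prod>i\<in>{1..length n}. 1 - \<psi> (take i n) (restrict x {..<i}))"

lemma continued_Nil: "continued \<psi> [] x = 1"
  by (simp add: continued_def)

lemma continued_eq:
  assumes "n \<noteq> []" "x \<in> space (sample_measure M n)"
  shows "continued \<psi> n x = continue_prob \<psi> n x * (1 - \<psi> n x)"
proof -
  have "{1..length n} = insert (length n) {1..<length n}"
    using assms(1) by (auto simp: Suc_le_eq)
  then show ?thesis
    by (simp add: continued_def continue_prob_def restrict_space_sample_measure[OF assms(2)] mult.commute)
qed

text \<open>The decision to take a group cannot depend on its content: for
  \<open>i \<le> length n\<close> the restriction to the first \<open>i\<close> groups discards the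
  new coordinate.\<close>

lemma continue_prob_update:
  "continue_prob \<psi> (n @ [m]) (x(length n := w)) = continued \<psi> n x"
proof -
  have "restrict (x(length n := w)) {..<i} = restrict x {..<i}" if "i \<le> length n" for i
    using that by (auto simp: restrict_def)
  then show ?thesis
    by (simp add: continue_prob_def continued_def atLeastLessThanSuc_atLeastAtMost)
qed

context
  fixes M :: "'a measure" and G :: "nat set" and \<psi> :: "'a rule"
  assumes rule: "randomized_rule M G \<psi>"
begin

lemma prefix_rule_bounds:
  assumes "n \<in> size_vectors G k" "x \<in> space (sample_measure M n)" "1 \<le> i" "i \<le> length n"
  shows "0 \<le> \<psi> (take i n) (restrict x {..<i})" "\<psi> (take i n) (restrict x {..<i}) \<le> 1"
proof -
  have "take i n \<in> size_vectors G i"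
    using assms by (auto simp: size_vectors_def dest: in_set_takeD)
  moreover have "restrict x {..<i} \<in> space (sample_measure M (take i n))"
    using measurable_space[OF measurable_prefix[OF assms(4)] assms(2)] .
  ultimately show "0 \<le> \<psi> (take i n) (restrict x {..<i})" "\<psi> (take i n) (restrict x {..<i}) \<le> 1"
    using rule assms(3) unfolding randomized_rule_def by auto
qed

lemma measurable_prefix_rule:
  assumes "n \<in> size_vectors G k" "1 \<le> i" "i \<le> length n"
  shows "(\<lambda>x. \<psi> (take i n) (restrict x {..<i})) \<in> borel_measurable (sample_measure M n)"
proof (rule measurable_compose[OF measurable_prefix[OF assms(3)]])
  have "take i n \<in> size_vectors G i"
    using assms by (auto simp: size_vectors_def dest: in_set_takeD)
  then show "\<psi> (take i n) \<in> borel_measurable (sample_measure M (take i n))"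
    using rule assms(2) unfolding randomized_rule_def by auto
qed

lemma rule_bounds:
  assumes "n \<in> size_vectors G (Suc k)" "x \<in> space (sample_measure M n)"
  shows "0 \<le> \<psi> n x" "\<psi> n x \<le> 1"
  using rule assms unfolding randomized_rule_def by auto

lemma measurable_rule:
  assumes "n \<in> size_vectors G (Suc k)"
  shows "\<psi> n \<in> borel_measurable (sample_measure M n)"
  using rule assms unfolding randomized_rule_def by auto

lemma continued_bounds:
  assumes "n \<in> size_vectors G k" "x \<in> space (sample_measure M n)"
  shows "0 \<le> continued \<psi> n x" "continued \<psi> n x \<le> 1"
  using prefix_rule_bounds[OF assms] unfolding continued_def
  by (auto intro!: prod_nonneg prod_le_1)

lemma continue_prob_bounds:
  assumes "n \<in> size_vectors G k" "x \<in> space (sample_measure M n)"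
  shows "0 \<le> continue_prob \<psi> n x" "continue_prob \<psi> n x \<le> 1"
  using prefix_rule_bounds[OF assms] unfolding continue_prob_def
  by (auto intro!: prod_nonneg prod_le_1)

lemma stop_prob_nonneg:
  assumes "n \<in> size_vectors G (Suc k)" "x \<in> space (sample_measure M n)"
  shows "0 \<le> stop_prob \<psi> n x"
  using continue_prob_bounds[OF assms] rule_bounds[OF assms] by (simp add: stop_prob_def)

lemma measurable_continued:
  assumes "n \<in> size_vectors G k"
  shows "continued \<psi> n \<in> borel_measurable (sample_measure M n)"
  unfolding continued_def[abs_def]
  by (intro borel_measurable_prod borel_measurable_diff borel_measurable_const measurable_prefix_rule[OF assms]) auto

lemma measurable_continue_prob:
  assumes "n \<in> size_vectors G k"
  shows "continue_prob \<psi> n \<in> borel_measurable (sample_measure M n)"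
  unfolding continue_prob_def[abs_def]
  by (intro borel_measurable_prod borel_measurable_diff borel_measurable_const measurable_prefix_rule[OF assms]) auto

lemma measurable_stop_prob:
  assumes "n \<in> size_vectors G (Suc k)"
  shows "stop_prob \<psi> n \<in> borel_measurable (sample_measure M n)"
  unfolding stop_prob_def[abs_def]
  by (intro borel_measurable_times measurable_continue_prob[OF assms] measurable_rule[OF assms])

lemma stop_plus_continued:
  assumes "n \<in> size_vectors G (Suc k)" "x \<in> space (sample_measure M n)"
  shows "ennreal (stop_prob \<psi> n x) + ennreal (continued \<psi> n x) = ennreal (continue_prob \<psi> n x)"
proof -
  have "n \<noteq> []" using assms by (auto simp: size_vectors_def)
  then have "stop_prob \<psi> n x + continued \<psi> n x = continue_prob \<psi> n x"
    by (simp add: continued_eq[OF _ assms(2)] stop_prob_def algebra_simps)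
  then show ?thesis
    using stop_prob_nonneg[OF assms] continued_bounds[OF assms] by (simp flip: ennreal_plus)
qed

end

section \<open>Averages over one stage and their recursion\<close>

locale group_sampling = sigma_finite_measure M for M :: "'a measure" +
  fixes p :: "nat pmf" and G :: "nat set"
  assumes sizes_subset: "set_pmf p \<subseteq> G"
begin

definition stage :: "nat \<Rightarrow> (nat list \<Rightarrow> 'a sample \<Rightarrow> ennreal) \<Rightarrow> ennreal" where
  "stage k \<Phi> = (\<integral>\<^sup>+n. \<integral>\<^sup>+x. \<Phi> n x \<partial>sample_measure M n \<partial>sizes_pmf p k)"

definition stage_measurable :: "nat \<Rightarrow> (nat list \<Rightarrow> 'a sample \<Rightarrow> ennreal) \<Rightarrow> bool" where
  "stage_measurable k \<Phi> \<longleftrightarrow> (\<forall>n\<in>size_vectors G k. \<Phi> n \<in> borel_measurable (sample_measure M n))"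

definition average_next :: "(nat list \<Rightarrow> 'a sample \<Rightarrow> ennreal) \<Rightarrow> nat list \<Rightarrow> 'a sample \<Rightarrow> ennreal" where
  "average_next \<Phi> n x = (\<integral>\<^sup>+m. \<integral>\<^sup>+w. \<Phi> (n @ [m]) (x(length n := w)) \<partial>PiM {..<m} (\<lambda>_. M) \<partial>p)"

lemma AE_sizes: "(\<And>n. n \<in> size_vectors G k \<Longrightarrow> P n) \<Longrightarrow> AE n in sizes_pmf p k. P n"
  using set_sizes_pmf[OF sizes_subset] by (auto simp: AE_measure_pmf_iff)

lemma stage_mono:
  assumes "\<And>n x. n \<in> size_vectors G k \<Longrightarrow> x \<in> space (sample_measure M n) \<Longrightarrow> \<Phi> n x \<le> \<Psi> n x"
  shows "stage k \<Phi> \<le> stage k \<Psi>"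
  unfolding stage_def by (intro nn_integral_mono_AE AE_sizes nn_integral_mono assms)

lemma stage_cong:
  assumes "\<And>n x. n \<in> size_vectors G k \<Longrightarrow> x \<in> space (sample_measure M n) \<Longrightarrow> \<Phi> n x = \<Psi> n x"
  shows "stage k \<Phi> = stage k \<Psi>"
  unfolding stage_def by (intro nn_integral_cong_AE AE_sizes nn_integral_cong assms)

lemma stage_add:
  assumes "stage_measurable k \<Phi>" "stage_measurable k \<Psi>"
  shows "stage k (\<lambda>n x. \<Phi> n x + \<Psi> n x) = stage k \<Phi> + stage k \<Psi>"
proof -
  have "stage k (\<lambda>n x. \<Phi> n x + \<Psi> n x) =
      (\<integral>\<^sup>+n. (\<integral>\<^sup>+x. \<Phi> n x \<partial>sample_measure M n) + (\<integral>\<^sup>+x. \<Psi> n x \<partial>sample_measure M n) \<partial>sizes_pmf p k)"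
    unfolding stage_def
    by (intro nn_integral_cong_AE AE_sizes nn_integral_add) (use assms in \<open>auto simp: stage_measurable_def\<close>)
  then show ?thesis by (simp add: nn_integral_add stage_def)
qed

lemma stage_weight:
  assumes "stage_measurable k \<Phi>"
  shows "stage k (\<lambda>n x. b n * \<Phi> n x) = (\<integral>\<^sup>+n. b n * (\<integral>\<^sup>+x. \<Phi> n x \<partial>sample_measure M n) \<partial>sizes_pmf p k)"
  unfolding stage_def
  by (intro nn_integral_cong_AE AE_sizes nn_integral_cmult) (use assms in \<open>auto simp: stage_measurable_def\<close>)

lemma stage_cmult:
  assumes "stage_measurable k \<Phi>"
  shows "stage k (\<lambda>n x. t * \<Phi> n x) = t * stage k \<Phi>"
  using stage_weight[OF assms, of "\<lambda>_. t"] by (simp add: nn_integral_cmult stage_def)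

lemma stage_measurable_add:
  assumes "stage_measurable k \<Phi>" "stage_measurable k \<Psi>"
  shows "stage_measurable k (\<lambda>n x. \<Phi> n x + \<Psi> n x)"
  using assms by (auto simp: stage_measurable_def intro!: borel_measurable_add)

lemma stage_measurable_cmult:
  assumes "stage_measurable k \<Phi>"
  shows "stage_measurable k (\<lambda>n x. t * \<Phi> n x)"
  using assms by (auto simp: stage_measurable_def)

lemma stage_0: "stage 0 \<Phi> = \<Phi> [] (\<lambda>_. undefined)"
  by (simp add: stage_def nn_integral_return_pmf sample_measure_def PiM_empty nn_integral_count_space_finite)

lemma size_vectors_snoc:
  assumes "n \<in> size_vectors G k" "m \<in> set_pmf p"
  shows "n @ [m] \<in> size_vectors G (Suc k)"
  using assms sizes_subset by (auto simp: size_vectors_def)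

lemma measurable_update_section:
  assumes "h \<in> borel_measurable (sample_measure M (n @ [m]))" "x \<in> space (sample_measure M n)"
  shows "(\<lambda>w. h (x(length n := w)) :: ennreal) \<in> borel_measurable (PiM {..<m} (\<lambda>_. M))"
  using measurable_compose[OF measurable_compose[OF measurable_Pair1'[OF assms(2)]
      measurable_sample_measure_update] assms(1)]
  by simp

lemma measurable_update_integral:
  assumes "h \<in> borel_measurable (sample_measure M (n @ [m]))"
  shows "(\<lambda>x. \<integral>\<^sup>+w. h (x(length n := w)) \<partial>PiM {..<m} (\<lambda>_. M)) \<in> borel_measurable (sample_measure M n)"
  by (rule sigma_finite_measure.borel_measurable_nn_integral[OF sigma_finite_group])
    (use measurable_compose[OF measurable_sample_measure_update assms] in \<open>simp add: case_prod_unfold\<close>)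

text \<open>Tonelli for the last group. The average over its size is written as a series, so only
  sums and integrals over the samples are exchanged.\<close>

lemma stage_Suc:
  assumes "stage_measurable (Suc k) \<Phi>"
  shows "stage (Suc k) \<Phi> = stage k (average_next \<Phi>)"
proof -
  have "stage (Suc k) \<Phi> = (\<integral>\<^sup>+n. \<integral>\<^sup>+m. \<integral>\<^sup>+x. \<Phi> (n @ [m]) x \<partial>sample_measure M (n @ [m]) \<partial>p \<partial>sizes_pmf p k)"
    by (simp add: stage_def nn_integral_pair_pmf')
  also have "\<dots> = (\<integral>\<^sup>+n. \<integral>\<^sup>+x. average_next \<Phi> n x \<partial>sample_measure M n \<partial>sizes_pmf p k)"
  proof (intro nn_integral_cong_AE AE_sizes)
    fix n assume n: "n \<in> size_vectors G k"
    have meas: "\<Phi> (n @ [m]) \<in> borel_measurable (sample_measure M (n @ [m]))" if "m \<in> set_pmf p" for m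
      using size_vectors_snoc[OF n that] assms by (auto simp: stage_measurable_def)
    define g where "g m x = (\<integral>\<^sup>+w. \<Phi> (n @ [m]) (x(length n := w)) \<partial>PiM {..<m} (\<lambda>_. M))" for m x
    \<comment> \<open>Outside the support of \<open>p\<close> nothing is known about the
      measurability of \<open>g m\<close>, but there the weight is zero; keeping the weight inside
      the integral makes every summand measurable.\<close>
    have g: "(\<lambda>x. ennreal (pmf p m) * g m x) \<in> borel_measurable (sample_measure M n)" for m
    proof (cases "m \<in> set_pmf p")
      case True
      then show ?thesis
        using measurable_update_integral[OF meas[OF True]] unfolding g_def by simp
    qed (simp add: set_pmf_iff)
    have "(\<integral>\<^sup>+m. \<integral>\<^sup>+x. \<Phi> (n @ [m]) x \<partial>sample_measure M (n @ [m]) \<partial>p) =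
        (\<integral>\<^sup>+m. \<integral>\<^sup>+x. g m x \<partial>sample_measure M n \<partial>p)"
      unfolding g_def
      by (rule nn_integral_cong_AE) (auto simp: AE_measure_pmf_iff nn_integral_sample_measure_snoc meas)
    also have "\<dots> = (\<Sum>m. ennreal (pmf p m) * (\<integral>\<^sup>+x. g m x \<partial>sample_measure M n))"
      by (rule nn_integral_pmf_eq_suminf)
    also have "\<dots> = (\<Sum>m. \<integral>\<^sup>+x. ennreal (pmf p m) * g m x \<partial>sample_measure M n)"
    proof (rule suminf_cong)
      fix m show "ennreal (pmf p m) * (\<integral>\<^sup>+x. g m x \<partial>sample_measure M n) =
          (\<integral>\<^sup>+x. ennreal (pmf p m) * g m x \<partial>sample_measure M n)"
      proof (cases "m \<in> set_pmf p")
        case True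
        then show ?thesis
          using measurable_update_integral[OF meas[OF True]] unfolding g_def
          by (simp add: nn_integral_cmult)
      qed (simp add: set_pmf_iff)
    qed
    also have "\<dots> = (\<integral>\<^sup>+x. (\<Sum>m. ennreal (pmf p m) * g m x) \<partial>sample_measure M n)"
      by (rule nn_integral_suminf[symmetric]) (rule g)
    also have "\<dots> = (\<integral>\<^sup>+x. average_next \<Phi> n x \<partial>sample_measure M n)"
      by (simp add: average_next_def g_def nn_integral_pmf_eq_suminf)
    finally show "(\<integral>\<^sup>+m. \<integral>\<^sup>+x. \<Phi> (n @ [m]) x \<partial>sample_measure M (n @ [m]) \<partial>p) =
        (\<integral>\<^sup>+x. average_next \<Phi> n x \<partial>sample_measure M n)" .
  qed
  finally show ?thesis by (simp add: stage_def)
qed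

lemma stage_measurable_continued:
  assumes "randomized_rule M G \<psi>" "stage_measurable k \<Phi>"
  shows "stage_measurable k (\<lambda>n x. ennreal (continued \<psi> n x) * \<Phi> n x)"
  using assms measurable_continued[OF assms(1)] unfolding stage_measurable_def
  by (auto intro!: borel_measurable_times_ennreal measurable_compose[OF _ measurable_ennreal])

lemma stage_measurable_stop_prob:
  assumes "randomized_rule M G \<psi>" "stage_measurable (Suc k) \<Phi>"
  shows "stage_measurable (Suc k) (\<lambda>n x. ennreal (stop_prob \<psi> n x) * \<Phi> n x)"
  using assms measurable_stop_prob[OF assms(1)] unfolding stage_measurable_def
  by (auto intro!: borel_measurable_times_ennreal measurable_compose[OF _ measurable_ennreal])

text \<open>A balance equation: what is still running after \<open>k\<close> groups either stops
  after the next group or keeps running. The factor \<open>continue_prob\<close> of the longer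
  vector does not see the new group, so it leaves the average as \<open>continued\<close>.\<close>

lemma stage_step:
  assumes rule: "randomized_rule M G \<psi>" and meas: "stage_measurable (Suc k) \<Phi>"
  shows "stage k (\<lambda>n x. ennreal (continued \<psi> n x) * average_next \<Phi> n x) =
    stage (Suc k) (\<lambda>n x. ennreal (stop_prob \<psi> n x) * \<Phi> n x) +
    stage (Suc k) (\<lambda>n x. ennreal (continued \<psi> n x) * \<Phi> n x)"
proof -
  have m: "stage_measurable (Suc k) (\<lambda>n x. ennreal (continue_prob \<psi> n x) * \<Phi> n x)"
    using meas measurable_continue_prob[OF rule] unfolding stage_measurable_def
    by (auto intro!: borel_measurable_times_ennreal measurable_compose[OF _ measurable_ennreal])
  have "stage (Suc k) (\<lambda>n x. ennreal (stop_prob \<psi> n x) * \<Phi> n x) +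
      stage (Suc k) (\<lambda>n x. ennreal (continued \<psi> n x) * \<Phi> n x) =
      stage (Suc k) (\<lambda>n x. ennreal (stop_prob \<psi> n x) * \<Phi> n x + ennreal (continued \<psi> n x) * \<Phi> n x)"
    by (rule stage_add[symmetric]) (intro stage_measurable_stop_prob stage_measurable_continued assms)+
  also have "\<dots> = stage (Suc k) (\<lambda>n x. ennreal (continue_prob \<psi> n x) * \<Phi> n x)"
    by (rule stage_cong) (simp add: stop_plus_continued[OF rule] flip: distrib_right)
  also have "\<dots> = stage k (average_next (\<lambda>n x. ennreal (continue_prob \<psi> n x) * \<Phi> n x))"
    by (rule stage_Suc[OF m])
  also have "\<dots> = stage k (\<lambda>n x. ennreal (continued \<psi> n x) * average_next \<Phi> n x)"
  proof (rule stage_cong)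
    fix n x assume n: "n \<in> size_vectors G k" and x: "x \<in> space (sample_measure M n)"
    have "average_next (\<lambda>n x. ennreal (continue_prob \<psi> n x) * \<Phi> n x) n x =
        (\<integral>\<^sup>+m. ennreal (continued \<psi> n x) * (\<integral>\<^sup>+w. \<Phi> (n @ [m]) (x(length n := w)) \<partial>PiM {..<m} (\<lambda>_. M)) \<partial>p)"
      unfolding average_next_def continue_prob_update
    proof (rule nn_integral_cong_AE, unfold AE_measure_pmf_iff, intro ballI nn_integral_cmult measurable_update_section x)
      fix m assume "m \<in> set_pmf p"
      then show "\<Phi> (n @ [m]) \<in> borel_measurable (sample_measure M (n @ [m]))"
        using size_vectors_snoc[OF n] meas by (auto simp: stage_measurable_def)
    qed
    then show "average_next (\<lambda>n x. ennreal (continue_prob \<psi> n x) * \<Phi> n x) n x =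
        ennreal (continued \<psi> n x) * average_next \<Phi> n x"
      by (simp add: average_next_def nn_integral_cmult)
  qed
  finally show ?thesis by simp
qed

end

section \<open>Termination and Wald's identity under one density\<close>

locale density_sampling = group_sampling M p G for M :: "'a measure" and p G +
  fixes f :: "'a \<Rightarrow> real"
  assumes f_measurable [measurable]: "f \<in> borel_measurable M"
    and f_nonneg: "\<And>x. x \<in> space M \<Longrightarrow> 0 \<le> f x"
    and f_integral: "(\<integral>\<^sup>+x. ennreal (f x) \<partial>M) = 1"
begin

text \<open>The probability that sampling has not stopped after \<open>k\<close> groups. Its sum
  over \<open>k\<close> is the expected number of groups.\<close>

definition reach :: "'a rule \<Rightarrow> nat \<Rightarrow> ennreal" where
  "reach \<psi> k = stage k (\<lambda>n x. ennreal (continued \<psi> n x) * ennreal (joint_density f n x))"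

lemma stage_measurable_density: "stage_measurable k (\<lambda>n x. ennreal (joint_density f n x))"
  by (simp add: stage_measurable_def)

lemma stage_measurable_weighted_density: "stage_measurable k (\<lambda>n x. b n * ennreal (joint_density f n x))"
  by (simp add: stage_measurable_def)

lemma average_next_weighted_density:
  assumes "x \<in> space (sample_measure M n)"
  shows "average_next (\<lambda>n x. b n * ennreal (joint_density f n x)) n x =
    (\<integral>\<^sup>+m. b (n @ [m]) \<partial>p) * ennreal (joint_density f n x)"
proof -
  have "0 \<le> joint_density f n x"
    using f_nonneg assms by (rule joint_density_nonneg)
  then show ?thesis
    by (simp add: average_next_def joint_density_update nn_integral_cmult nn_integral_multc
        nn_integral_mult_group_density f_nonneg f_integral)
qed

lemma reach_0: "reach \<psi> 0 = 1"
  by (simp add: reach_def stage_0 continued_Nil joint_density_def)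

lemma sample_expectation_stage:
  assumes "\<And>n x. n \<in> size_vectors G k \<Longrightarrow> x \<in> space (sample_measure M n) \<Longrightarrow> 0 \<le> h n x"
  shows "(\<integral>\<^sup>+n. sample_expectation M f n (h n) \<partial>sizes_pmf p k) =
    stage k (\<lambda>n x. ennreal (h n x) * ennreal (joint_density f n x))"
proof -
  have "(\<integral>\<^sup>+n. sample_expectation M f n (h n) \<partial>sizes_pmf p k) = stage k (\<lambda>n x. ennreal (h n x * joint_density f n x))"
    by (simp add: sample_expectation_def stage_def)
  also have "\<dots> = stage k (\<lambda>n x. ennreal (h n x) * ennreal (joint_density f n x))"
    by (intro stage_cong ennreal_mult assms joint_density_nonneg[of M f]) (auto simp: f_nonneg)
  finally show ?thesis .
qed

lemma stage_sum_sample_expectation: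
  assumes "\<And>k n x. n \<in> size_vectors G (Suc k) \<Longrightarrow> x \<in> space (sample_measure M n) \<Longrightarrow> 0 \<le> h n x"
  shows "stage_sum p G (\<lambda>n. sample_expectation M f n (h n)) =
    (\<Sum>k. stage (Suc k) (\<lambda>n x. ennreal (h n x) * ennreal (joint_density f n x)))"
  unfolding stage_sum_eq_suminf[OF sizes_subset]
  by (intro suminf_cong sample_expectation_stage assms)

context
  fixes \<psi> :: "'a rule"
  assumes rule: "randomized_rule M G \<psi>"
begin

lemma weighted_density_step:
  \<comment> \<open>The weight \<open>b\<close> depends on the sizes only, so averaging over the
    next group changes just \<open>b\<close>, while the density of the new observations integrates
    to 1.\<close>
  "stage k (\<lambda>n x. ennreal (continued \<psi> n x) * ((\<integral>\<^sup>+m. b (n @ [m]) \<partial>p) * ennreal (joint_density f n x))) =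
    stage (Suc k) (\<lambda>n x. ennreal (stop_prob \<psi> n x) * (b n * ennreal (joint_density f n x))) +
    stage (Suc k) (\<lambda>n x. ennreal (continued \<psi> n x) * (b n * ennreal (joint_density f n x)))"
  unfolding stage_step[OF rule stage_measurable_weighted_density, symmetric]
  by (rule stage_cong) (simp add: average_next_weighted_density)

lemma reach_Suc:
  "reach \<psi> k = stage (Suc k) (\<lambda>n x. ennreal (stop_prob \<psi> n x) * ennreal (joint_density f n x)) + reach \<psi> (Suc k)"
  using weighted_density_step[of k "\<lambda>_. 1"]
  by (simp add: reach_def measure_pmf.emeasure_space_1)

lemma sum_stop_plus_reach:
  "(\<Sum>j<k. stage (Suc j) (\<lambda>n x. ennreal (stop_prob \<psi> n x) * ennreal (joint_density f n x))) + reach \<psi> k = 1"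
proof (induction k)
  case (Suc k)
  then show ?case by (simp add: reach_Suc[of k] add.assoc)
qed (simp add: reach_0)

text \<open>The probability of having stopped and \<open>reach\<close> add up to 1 at every stage,
  and \<open>reach\<close> decreases; in the limit the total stopping probability misses 1 exactly
  by the limit of \<open>reach\<close>.\<close>

lemma terminating_iff_reach:
  "\<psi> \<in> terminating_rules M G p f \<longleftrightarrow> reach \<psi> \<longlonglongrightarrow> 0"
proof -
  let ?s = "\<lambda>k. stage (Suc k) (\<lambda>n x. ennreal (stop_prob \<psi> n x) * ennreal (joint_density f n x))"
  have "stage_sum p G (\<lambda>n. sample_expectation M f n (stop_prob \<psi> n)) = (\<Sum>k. ?s k)"
    by (rule stage_sum_sample_expectation) (rule stop_prob_nonneg[OF rule])
  then have iff: "\<psi> \<in> terminating_rules M G p f \<longleftrightarrow> (\<Sum>k. ?s k) = 1"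
    using rule by (simp add: terminating_rules_def)
  have sums: "(\<lambda>k. \<Sum>j<k. ?s j) \<longlonglongrightarrow> (\<Sum>k. ?s k)"
    by (rule summable_LIMSEQ) simp
  have "decseq (reach \<psi>)"
    by (rule decseq_SucI) (subst (2) reach_Suc, simp)
  then obtain r where r: "reach \<psi> \<longlonglongrightarrow> r"
    using LIMSEQ_INF by blast
  have "(\<lambda>k. (\<Sum>j<k. ?s j) + reach \<psi> k) \<longlonglongrightarrow> (\<Sum>k. ?s k) + r"
    by (intro tendsto_add sums r)
  then have total: "(\<Sum>k. ?s k) + r = 1"
    by (simp only: sum_stop_plus_reach LIMSEQ_const_iff)
  have "(\<Sum>k. ?s k) = 1 \<longleftrightarrow> r = 0"
  proof
    assume "(\<Sum>k. ?s k) = 1"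
    with total have "1 + r = 1 + 0" by simp
    then show "r = 0" by (simp only: ennreal_add_left_cancel) simp
  next
    assume "r = 0"
    with total show "(\<Sum>k. ?s k) = 1" by simp
  qed
  also have "r = 0 \<longleftrightarrow> reach \<psi> \<longlonglongrightarrow> 0"
    using r LIMSEQ_unique by blast
  finally show ?thesis using iff by simp
qed

text \<open>Whether the next group is bought depends on the past and is independent of its size, so
  each purchase costs \<open>C\<close> on average. The difficulty is the cost carried by paths still
  running: group costs may be unbounded, so \<open>reach\<close> tending to 0 does not by itself
  make this term vanish.\<close>

lemma average_cost_wald:
  fixes c :: "nat \<Rightarrow> real"
  assumes c: "\<And>m. m \<in> G \<Longrightarrow> 0 \<le> c m" and reach: "reach \<psi> \<longlonglongrightarrow> 0"
  shows "average_cost M G p c f \<psi> = (\<integral>\<^sup>+m. ennreal (c m) \<partial>p) * (\<Sum>k. reach \<psi> k)"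
proof -
  define C where "C = (\<integral>\<^sup>+m. ennreal (c m) \<partial>p)"
  define b where "b n = ennreal (total_cost c n)" for n
  define stopped where "stopped h k = stage (Suc k) (\<lambda>n x. ennreal (stop_prob \<psi> n x) * (h n * ennreal (joint_density f n x)))" for h k
  define running where "running h k = stage k (\<lambda>n x. ennreal (continued \<psi> n x) * (h n * ennreal (joint_density f n x)))" for h k
  have step: "running (\<lambda>n. \<integral>\<^sup>+m. h (n @ [m]) \<partial>p) k = stopped h k + running h (Suc k)" for h k
    unfolding running_def stopped_def by (rule weighted_density_step)
  have running_weight: "running h k = (\<integral>\<^sup>+n. h n * (\<integral>\<^sup>+x. ennreal (continued \<psi> n x) * ennreal (joint_density f n x) \<partial>sample_measure M n) \<partial>sizes_pmf p k)" for h k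
    using stage_weight[OF stage_measurable_continued[OF rule stage_measurable_density], of k h]
    by (simp add: running_def mult.left_commute)
  have running_mono: "running h k \<le> running h' k" if "\<And>n. n \<in> size_vectors G k \<Longrightarrow> h n \<le> h' n" for h h' k
    unfolding running_def using that by (intro stage_mono mult_left_mono mult_right_mono) auto
  have stopped_mono: "stopped h k \<le> stopped h' k" if "\<And>n. h n \<le> h' n" for h h' k
    unfolding stopped_def using that by (intro stage_mono mult_left_mono mult_right_mono) auto
  have b_snoc: "b (n @ [m]) = b n + ennreal (c m)" if "n \<in> size_vectors G k" "m \<in> set_pmf p" for n m k
  proof -
    have "0 \<le> total_cost c n"
      unfolding total_cost_def
    proof (intro sum_nonneg c)
      fix i assume "i \<in> {..<length n}"
      then show "n ! i \<in> G"
        using that(1) nth_mem[of i n] by (auto simp: size_vectors_def simp del: nth_mem)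
    qed
    moreover have "total_cost c (n @ [m]) = total_cost c n + c m"
      by (simp add: total_cost_def nth_append)
    ultimately show ?thesis
      using c[of m] that sizes_subset by (auto simp: b_def)
  qed
  have "(\<integral>\<^sup>+m. b (n @ [m]) \<partial>p) = b n + C" if n: "n \<in> size_vectors G k" for n k
  proof -
    have "(\<integral>\<^sup>+m. b (n @ [m]) \<partial>p) = (\<integral>\<^sup>+m. b n + ennreal (c m) \<partial>p)"
      by (rule nn_integral_cong_AE) (simp add: AE_measure_pmf_iff b_snoc[OF n])
    then show ?thesis
      by (simp add: C_def nn_integral_add measure_pmf.emeasure_space_1)
  qed
  then have "running (\<lambda>n. \<integral>\<^sup>+m. b (n @ [m]) \<partial>p) k = running (\<lambda>n. b n + C) k" for k
    by (intro antisym running_mono) auto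
  also have "running (\<lambda>n. b n + C) k = running b k + C * reach \<psi> k" for k
    unfolding running_weight
    by (simp add: distrib_right nn_integral_add nn_integral_cmult reach_def stage_def)
  finally have wald_step: "running b k + C * reach \<psi> k = stopped b k + running b (Suc k)" for k
    using step[of b k] by simp
  \<comment> \<open>The cost of all groups bought so far is either settled by stopping or carried by
    the paths still running.\<close>
  have wald: "C * (\<Sum>j<k. reach \<psi> j) = (\<Sum>j<k. stopped b j) + running b k" for k
  proof (induction k)
    case 0
    then show ?case by (simp add: running_def stage_0 b_def total_cost_def)
  next
    case (Suc k)
    have "C * (\<Sum>j<Suc k. reach \<psi> j) = (\<Sum>j<k. stopped b j) + (running b k + C * reach \<psi> k)"
      by (simp add: distrib_left Suc add.assoc)
    then show ?case by (simp add: wald_step add.assoc)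
  qed
  have cost: "average_cost M G p c f \<psi> = (\<Sum>k. stopped b k)"
    unfolding average_cost_def stage_sum_eq_suminf[OF sizes_subset]
  proof (rule suminf_cong)
    fix k
    have "(\<integral>\<^sup>+n. b n * sample_expectation M f n (stop_prob \<psi> n) \<partial>sizes_pmf p (Suc k)) =
        (\<integral>\<^sup>+n. b n * (\<integral>\<^sup>+x. ennreal (stop_prob \<psi> n x) * ennreal (joint_density f n x) \<partial>sample_measure M n) \<partial>sizes_pmf p (Suc k))"
    proof (intro nn_integral_cong_AE AE_sizes arg_cong[where f = "times (b _)"])
      fix n assume "n \<in> size_vectors G (Suc k)"
      then show "sample_expectation M f n (stop_prob \<psi> n) =
          (\<integral>\<^sup>+x. ennreal (stop_prob \<psi> n x) * ennreal (joint_density f n x) \<partial>sample_measure M n)"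
        unfolding sample_expectation_def
        by (intro nn_integral_cong ennreal_mult stop_prob_nonneg[OF rule] joint_density_nonneg[of M f])
          (auto simp: f_nonneg)
    qed
    also have "\<dots> = stopped b k"
      using stage_weight[OF stage_measurable_stop_prob[OF rule stage_measurable_density], of k b]
      by (simp add: stopped_def mult.left_commute)
    finally show "(\<integral>\<^sup>+n. ennreal (total_cost c n) * sample_expectation M f n (stop_prob \<psi> n) \<partial>sizes_pmf p (Suc k)) = stopped b k"
      by (simp add: b_def)
  qed
  \<comment> \<open>Capping the cost at \<open>t\<close> makes the part still running at stage \<open>l\<close> at most \<open>t * reach \<psi> l\<close>, which vanishes.\<close>
  have capped: "(\<Sum>j<k. stopped b j) + running (\<lambda>n. min (b n) (of_nat t)) k \<le> (\<Sum>k. stopped b k)" for k t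
  proof (rule LIMSEQ_le_const)
    let ?h = "\<lambda>n. min (b n) (of_nat t)"
    \<comment> \<open>Adding a group never lowers the capped cost of a path, so what runs at stage
      \<open>i\<close> reappears one stage later as stopped or running cost.\<close>
    have h: "running ?h i \<le> stopped b i + running ?h (Suc i)" for i
    proof -
      have "running ?h i \<le> running (\<lambda>n. \<integral>\<^sup>+m. ?h (n @ [m]) \<partial>p) i"
      proof (rule running_mono)
        fix n assume n: "n \<in> size_vectors G i"
        have "?h n = (\<integral>\<^sup>+m. ?h n \<partial>p)"
          by (simp add: measure_pmf.emeasure_space_1)
        also have "\<dots> \<le> (\<integral>\<^sup>+m. ?h (n @ [m]) \<partial>p)"
          by (rule nn_integral_mono_AE) (auto simp: AE_measure_pmf_iff b_snoc[OF n] intro: min.coboundedI1)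
        finally show "?h n \<le> (\<integral>\<^sup>+m. ?h (n @ [m]) \<partial>p)" .
      qed
      also have "\<dots> = stopped ?h i + running ?h (Suc i)"
        by (rule step)
      also have "\<dots> \<le> stopped b i + running ?h (Suc i)"
        by (intro add_right_mono stopped_mono) simp
      finally show ?thesis .
    qed
    have "(\<Sum>j<k. stopped b j) + running ?h k \<le> (\<Sum>j<l. stopped b j) + running ?h l" if "k \<le> l" for l
      using that
    proof (induction l rule: dec_induct)
      case (step l)
      note step(3)
      also have "(\<Sum>j<l. stopped b j) + running ?h l \<le> (\<Sum>j<l. stopped b j) + (stopped b l + running ?h (Suc l))"
        by (intro add_left_mono h)
      finally show ?case by (simp add: add.assoc)
    qed simp
    moreover have "running ?h l \<le> of_nat t * reach \<psi> l" for l
    proof -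
      have "running ?h l \<le> running (\<lambda>n. of_nat t) l" by (rule running_mono) simp
      then show ?thesis by (simp add: running_weight nn_integral_cmult reach_def stage_def)
    qed
    ultimately have "(\<Sum>j<k. stopped b j) + running ?h k \<le> (\<Sum>j<l. stopped b j) + of_nat t * reach \<psi> l" if "k \<le> l" for l
      using that by (meson add_left_mono order_trans)
    then show "\<exists>N. \<forall>l\<ge>N. (\<Sum>j<k. stopped b j) + running ?h k \<le> (\<Sum>j<l. stopped b j) + of_nat t * reach \<psi> l"
      by blast
    have "(\<lambda>l. (\<Sum>j<l. stopped b j) + of_nat t * reach \<psi> l) \<longlonglongrightarrow> (\<Sum>k. stopped b k) + of_nat t * 0"
      by (intro tendsto_add ennreal_tendsto_cmult reach summable_LIMSEQ) (auto simp: of_nat_less_top)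
    then show "(\<lambda>l. (\<Sum>j<l. stopped b j) + of_nat t * reach \<psi> l) \<longlonglongrightarrow> (\<Sum>k. stopped b k)"
      by simp
  qed
  \<comment> \<open>The cost of each single size vector is finite, so monotone convergence in
    \<open>t\<close> removes the cap.\<close>
  have running_SUP: "running b k = (SUP t. running (\<lambda>n. min (b n) (of_nat t)) k)" for k
  proof -
    have "b n = (SUP t. min (b n) (of_nat t))" for n
    proof (rule antisym)
      obtain t :: nat where "total_cost c n \<le> real t"
        using real_arch_simple by blast
      then have "b n \<le> of_nat t"
        by (simp add: b_def ennreal_le_iff ennreal_of_nat_eq_real_of_nat)
      then have "b n \<le> min (b n) (of_nat t)" by simp
      then show "b n \<le> (SUP t. min (b n) (of_nat t))"
        by (rule order_trans) (rule SUP_upper, simp)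
    qed (auto intro: SUP_least)
    then have "running b k = (\<integral>\<^sup>+n. (SUP t. min (b n) (of_nat t) *
        (\<integral>\<^sup>+x. ennreal (continued \<psi> n x) * ennreal (joint_density f n x) \<partial>sample_measure M n)) \<partial>sizes_pmf p k)"
      unfolding running_weight by (simp flip: SUP_mult_right_ennreal)
    also have "\<dots> = (SUP t. running (\<lambda>n. min (b n) (of_nat t)) k)"
      unfolding running_weight
      by (intro nn_integral_monotone_convergence_SUP)
        (auto simp: incseq_def le_fun_def intro!: mult_right_mono min.mono)
    finally show ?thesis .
  qed
  have upper: "C * (\<Sum>j<k. reach \<psi> j) \<le> (\<Sum>k. stopped b k)" for k
  proof -
    have "C * (\<Sum>j<k. reach \<psi> j) = (SUP t. (\<Sum>j<k. stopped b j) + running (\<lambda>n. min (b n) (of_nat t)) k)"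
      unfolding wald running_SUP by (simp add: ennreal_SUP_add_right)
    then show ?thesis by (simp add: SUP_le_iff capped)
  qed
  have "(\<Sum>k. stopped b k) = C * (\<Sum>k. reach \<psi> k)"
  proof (rule antisym)
    show "(\<Sum>k. stopped b k) \<le> C * (\<Sum>k. reach \<psi> k)"
    proof (rule suminf_le_const)
      fix k
      have "(\<Sum>j<k. stopped b j) \<le> C * (\<Sum>j<k. reach \<psi> j)"
        by (simp add: wald)
      also have "\<dots> \<le> C * (\<Sum>k. reach \<psi> k)"
        by (intro mult_left_mono sum_le_suminf) auto
      finally show "(\<Sum>j<k. stopped b j) \<le> C * (\<Sum>k. reach \<psi> k)" .
    qed simp
    have "C * (\<Sum>k. reach \<psi> k) = (\<Sum>k. C * reach \<psi> k)"
      by simp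
    also have "\<dots> \<le> (\<Sum>k. stopped b k)"
      by (rule suminf_le_const) (simp_all add: upper flip: sum_distrib_left)
    finally show "C * (\<Sum>k. reach \<psi> k) \<le> (\<Sum>k. stopped b k)" .
  qed
  then show ?thesis by (simp add: cost C_def)
qed

end

end

section \<open>Minimization of the total risk\<close>

text \<open>Telescoping without subtraction. The inequality accumulates the remainder
  \<open>R k\<close> on the larger side, so it has to vanish in the limit.\<close>

lemma ennreal_recursion_le:
  fixes c D R :: "nat \<Rightarrow> ennreal"
  assumes "\<And>k. R k \<le> D k + (c (Suc k) + R (Suc k))" and "R \<longlonglongrightarrow> 0"
  shows "c 0 + R 0 \<le> (\<Sum>k. c k) + (\<Sum>k. D k)"
proof (rule LIMSEQ_le_const)
  have "c 0 + R 0 \<le> (\<Sum>j<Suc k. c j) + (\<Sum>j<k. D j) + R k" for k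
  proof (induction k)
    case (Suc k)
    note Suc
    also have "(\<Sum>j<Suc k. c j) + (\<Sum>j<k. D j) + R k \<le>
        (\<Sum>j<Suc k. c j) + (\<Sum>j<k. D j) + (D k + (c (Suc k) + R (Suc k)))"
      by (intro add_left_mono assms)
    finally show ?case by (simp add: add_ac)
  qed simp
  then show "\<exists>N. \<forall>k\<ge>N. c 0 + R 0 \<le> (\<Sum>j<Suc k. c j) + (\<Sum>j<k. D j) + R k"
    by blast
  have "(\<lambda>k. (\<Sum>j<Suc k. c j) + (\<Sum>j<k. D j) + R k) \<longlonglongrightarrow> (\<Sum>k. c k) + (\<Sum>k. D k) + 0"
    by (intro tendsto_add LIMSEQ_Suc[where f = "\<lambda>k. \<Sum>j<k. c j"] summable_LIMSEQ assms(2)) auto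
  then show "(\<lambda>k. (\<Sum>j<Suc k. c j) + (\<Sum>j<k. D j) + R k) \<longlonglongrightarrow> (\<Sum>k. c k) + (\<Sum>k. D k)"
    by simp
qed

text \<open>The reverse telescoping: the remainder now stands on the smaller side and is dropped as
  a nonnegative term.\<close>

lemma ennreal_recursion_ge:
  fixes c D R :: "nat \<Rightarrow> ennreal"
  assumes "\<And>k. D k + (c (Suc k) + R (Suc k)) \<le> R k"
  shows "(\<Sum>k. c k) + (\<Sum>k. D k) \<le> c 0 + R 0"
proof (rule LIMSEQ_le_const2)
  have "(\<Sum>j<Suc k. c j) + (\<Sum>j<k. D j) + R k \<le> c 0 + R 0" for k
  proof (induction k)
    case (Suc k)
    have "(\<Sum>j<Suc (Suc k). c j) + (\<Sum>j<Suc k. D j) + R (Suc k) =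
        (\<Sum>j<Suc k. c j) + (\<Sum>j<k. D j) + (D k + (c (Suc k) + R (Suc k)))"
      by (simp add: add_ac)
    also have "\<dots> \<le> (\<Sum>j<Suc k. c j) + (\<Sum>j<k. D j) + R k"
      by (intro add_left_mono assms)
    finally show ?case using Suc by (rule order_trans)
  qed simp
  moreover have "(\<Sum>j<Suc k. c j) + (\<Sum>j<k. D j) \<le> (\<Sum>j<Suc k. c j) + (\<Sum>j<k. D j) + R k" for k
    by (rule add_increasing2) auto
  ultimately have "(\<Sum>j<Suc k. c j) + (\<Sum>j<k. D j) \<le> c 0 + R 0" for k
    by (blast intro: order_trans)
  then show "\<exists>N. \<forall>k\<ge>N. (\<Sum>j<Suc k. c j) + (\<Sum>j<k. D j) \<le> c 0 + R 0"
    by blast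
  show "(\<lambda>k. (\<Sum>j<Suc k. c j) + (\<Sum>j<k. D j)) \<longlonglongrightarrow> (\<Sum>k. c k) + (\<Sum>k. D k)"
    by (intro tendsto_add LIMSEQ_Suc[where f = "\<lambda>k. \<Sum>j<k. c j"] summable_LIMSEQ) auto
qed

section \<open>Both hypotheses together: the Lagrangian and its minimum\<close>

locale group_testing = two_densities M f0 f1 p + group_sampling M p G
  for M :: "'a measure" and f0 f1 p G
begin

sublocale d0: density_sampling M p G f0
  by unfold_locales (auto simp: f0_nonneg f0_integral)

sublocale d1: density_sampling M p G f1
  by unfold_locales (auto simp: f1_nonneg f1_integral)

lemma joint_density0_nonneg: "x \<in> space (sample_measure M n) \<Longrightarrow> 0 \<le> joint_density f0 n x"
  and joint_density1_nonneg: "x \<in> space (sample_measure M n) \<Longrightarrow> 0 \<le> joint_density f1 n x"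
  by (auto intro: joint_density_nonneg f0_nonneg f1_nonneg)

lemma average_next_joint:
  "average_next (\<lambda>n x. F (joint_density f0 n x) (joint_density f1 n x)) n x =
     next_group F (joint_density f0 n x) (joint_density f1 n x)"
  by (simp add: average_next_def next_group_def joint_density_update)

lemma stage_measurable_joint:
  assumes "case_prod F \<in> borel_measurable (borel \<Otimes>\<^sub>M borel)"
  shows "stage_measurable k (\<lambda>n x. F (joint_density f0 n x) (joint_density f1 n x))"
  unfolding stage_measurable_def by (auto intro!: measurable_curried[OF assms])

lemma stage_affinity:
  "stage k (\<lambda>n x. ennreal (sqrt (joint_density f0 n x * joint_density f1 n x))) = group_affinity ^ k"
proof (induction k)
  case 0
  then show ?case by (simp add: stage_0 joint_density_def)
next
  case (Suc k)
  have meas: "case_prod (\<lambda>x y. ennreal (sqrt (x * y))) \<in> borel_measurable (borel \<Otimes>\<^sub>M borel)"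
    by (simp add: case_prod_unfold)
  have "stage (Suc k) (\<lambda>n x. ennreal (sqrt (joint_density f0 n x * joint_density f1 n x))) =
      stage k (\<lambda>n x. group_affinity * ennreal (sqrt (joint_density f0 n x * joint_density f1 n x)))"
    unfolding stage_Suc[OF stage_measurable_joint[OF meas]]
    by (intro stage_cong trans[OF average_next_joint[of "\<lambda>x y. ennreal (sqrt (x * y))"] next_group_sqrt]
        joint_density0_nonneg joint_density1_nonneg)
  then show ?case
    by (simp add: stage_cmult[OF stage_measurable_joint[OF meas]] Suc)
qed

lemma group_affinity_power_tendsto_0: "(\<lambda>k. group_affinity ^ k) \<longlonglongrightarrow> 0"
proof -
  obtain r where r: "group_affinity = ennreal r" "0 \<le> r" "r < 1"
    using group_affinity_less_1 by (cases group_affinity) (auto simp: ennreal_less_one_iff)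
  have "(\<lambda>k. ennreal (r ^ k)) \<longlonglongrightarrow> ennreal 0"
    using r by (intro tendsto_ennrealI LIMSEQ_realpow_zero)
  then show ?thesis using r by (simp add: ennreal_power)
qed


text \<open>The Lagrangian with sampling charged per group under each hypothesis; Wald's identity
  converts its first part into average costs.\<close>

definition total_risk ::
  "ennreal \<Rightarrow> ennreal \<Rightarrow> ennreal \<Rightarrow> ennreal \<Rightarrow> 'a rule \<Rightarrow> 'a rule \<Rightarrow> ennreal" where
  "total_risk a0 a1 l0 l1 \<psi> \<phi> =
     (a0 * (\<Sum>k. d0.reach \<psi> k) + a1 * (\<Sum>k. d1.reach \<psi> k)) +
     (l0 * error_prob1 M G p f0 \<psi> \<phi> + l1 * error_prob2 M G p f1 \<psi> \<phi>)"

definition stage_loss :: "ennreal \<Rightarrow> ennreal \<Rightarrow> 'a rule \<Rightarrow> 'a rule \<Rightarrow> nat \<Rightarrow> ennreal" where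
  "stage_loss l0 l1 \<psi> \<phi> k =
     l0 * stage (Suc k) (\<lambda>n x. ennreal (stop_prob \<psi> n x * \<phi> n x) * ennreal (joint_density f0 n x)) +
     l1 * stage (Suc k) (\<lambda>n x. ennreal (stop_prob \<psi> n x * (1 - \<phi> n x)) * ennreal (joint_density f1 n x))"

context
  fixes \<psi> \<phi> :: "'a rule" and a0 a1 l0 l1 :: ennreal
  assumes rule: "randomized_rule M G \<psi>" and decision: "randomized_rule M G \<phi>"
begin

lemma error_probs_eq:
  "error_prob1 M G p f0 \<psi> \<phi> =
     (\<Sum>k. stage (Suc k) (\<lambda>n x. ennreal (stop_prob \<psi> n x * \<phi> n x) * ennreal (joint_density f0 n x)))"
  "error_prob2 M G p f1 \<psi> \<phi> =
     (\<Sum>k. stage (Suc k) (\<lambda>n x. ennreal (stop_prob \<psi> n x * (1 - \<phi> n x)) * ennreal (joint_density f1 n x)))"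
  unfolding error_prob1_def error_prob2_def
  by (rule d0.stage_sum_sample_expectation d1.stage_sum_sample_expectation;
      auto intro!: mult_nonneg_nonneg stop_prob_nonneg[OF rule] rule_bounds[OF decision])+

lemma total_risk_eq:
  "total_risk a0 a1 l0 l1 \<psi> \<phi> =
     (\<Sum>k. a0 * d0.reach \<psi> k + a1 * d1.reach \<psi> k) + (\<Sum>k. stage_loss l0 l1 \<psi> \<phi> k)"
  by (simp add: total_risk_def stage_loss_def error_probs_eq flip: suminf_add)

lemma stage_loss_eq:
  "stage_loss l0 l1 \<psi> \<phi> k = stage (Suc k) (\<lambda>n x. ennreal (stop_prob \<psi> n x) *
     (l0 * (ennreal (\<phi> n x) * ennreal (joint_density f0 n x)) +
      l1 * (ennreal (1 - \<phi> n x) * ennreal (joint_density f1 n x))))"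
proof -
  have meas: "(\<lambda>x. ennreal (stop_prob \<psi> n x * \<phi> n x) * ennreal (joint_density f0 n x)) \<in> borel_measurable (sample_measure M n)"
    "(\<lambda>x. ennreal (stop_prob \<psi> n x * (1 - \<phi> n x)) * ennreal (joint_density f1 n x)) \<in> borel_measurable (sample_measure M n)"
    if "n \<in> size_vectors G (Suc k)" for n
  proof -
    note [measurable] = measurable_stop_prob[OF rule that] measurable_rule[OF decision that]
    show "(\<lambda>x. ennreal (stop_prob \<psi> n x * \<phi> n x) * ennreal (joint_density f0 n x)) \<in> borel_measurable (sample_measure M n)"
      "(\<lambda>x. ennreal (stop_prob \<psi> n x * (1 - \<phi> n x)) * ennreal (joint_density f1 n x)) \<in> borel_measurable (sample_measure M n)"
      by measurable
  qed
  have "stage_loss l0 l1 \<psi> \<phi> k = stage (Suc k) (\<lambda>n x.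
      l0 * (ennreal (stop_prob \<psi> n x * \<phi> n x) * ennreal (joint_density f0 n x)) +
      l1 * (ennreal (stop_prob \<psi> n x * (1 - \<phi> n x)) * ennreal (joint_density f1 n x)))"
    unfolding stage_loss_def using meas
    by (subst stage_add) (auto simp: stage_measurable_def stage_cmult)
  also have "\<dots> = stage (Suc k) (\<lambda>n x. ennreal (stop_prob \<psi> n x) *
     (l0 * (ennreal (\<phi> n x) * ennreal (joint_density f0 n x)) +
      l1 * (ennreal (1 - \<phi> n x) * ennreal (joint_density f1 n x))))"
    by (rule stage_cong)
      (simp add: ennreal_mult stop_prob_nonneg[OF rule] rule_bounds[OF decision] distrib_left mult_ac)
  finally show ?thesis .
qed

definition continuing :: "(real \<Rightarrow> real \<Rightarrow> ennreal) \<Rightarrow> nat \<Rightarrow> ennreal" where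
  "continuing F k = stage k (\<lambda>n x. ennreal (continued \<psi> n x) * F (joint_density f0 n x) (joint_density f1 n x))"

private abbreviation "v \<equiv> risk a0 a1 l0 l1"
private abbreviation "h \<equiv> continuation_risk a0 a1 l0 l1"

lemma continuing_next_group:
  "continuing (next_group v) k =
     stage (Suc k) (\<lambda>n x. ennreal (stop_prob \<psi> n x) * v (joint_density f0 n x) (joint_density f1 n x)) +
     continuing v (Suc k)"
  unfolding continuing_def
    stage_step[OF rule stage_measurable_joint[OF measurable_risk], symmetric] average_next_joint ..

text \<open>A path still running pays for the next group at once, so the sampling price at stage
  \<open>k\<close> is weighted by the probability of reaching it.\<close>

lemma continuing_continuation_risk:
  "continuing h k = (a0 * d0.reach \<psi> k + a1 * d1.reach \<psi> k) + continuing (next_group v) k"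
proof -
  have m0: "stage_measurable k (\<lambda>n x. ennreal (continued \<psi> n x) * ennreal (joint_density f0 n x))"
    and m1: "stage_measurable k (\<lambda>n x. ennreal (continued \<psi> n x) * ennreal (joint_density f1 n x))"
    and m2: "stage_measurable k (\<lambda>n x. ennreal (continued \<psi> n x) *
        next_group v (joint_density f0 n x) (joint_density f1 n x))"
    by (rule stage_measurable_continued[OF rule]
        d0.stage_measurable_density d1.stage_measurable_density
        stage_measurable_joint[OF measurable_next_group[OF measurable_risk]])+
  have "continuing h k = stage k (\<lambda>n x.
      (a0 * (ennreal (continued \<psi> n x) * ennreal (joint_density f0 n x)) +
       a1 * (ennreal (continued \<psi> n x) * ennreal (joint_density f1 n x))) +
      ennreal (continued \<psi> n x) * next_group v (joint_density f0 n x) (joint_density f1 n x))"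
    unfolding continuing_def continuation_risk_def
    by (rule stage_cong) (simp add: distrib_left mult_ac)
  also have "\<dots> = (a0 * d0.reach \<psi> k + a1 * d1.reach \<psi> k) + continuing (next_group v) k"
    unfolding continuing_def d0.reach_def d1.reach_def
    by (simp only: stage_add stage_cmult stage_measurable_add stage_measurable_cmult m0 m1 m2)
  finally show ?thesis .
qed

lemma continuing_continuation_risk_0: "continuing h 0 = h 1 1"
  by (simp add: continuing_def stage_0 continued_Nil joint_density_def)

text \<open>At least one group is always taken, so the bound is the continuation risk at the initial
  densities \<open>(1, 1)\<close> and not \<open>v 1 1\<close>. Stopping costs at least
  \<open>v\<close> whatever \<open>\<phi>\<close> decides, since \<open>v\<close> is below both
  losses, and continuing costs \<open>h\<close>, which is also at least \<open>v\<close>.\<close>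

lemma continuation_risk_le_total_risk:
  assumes reach: "d0.reach \<psi> \<longlonglongrightarrow> 0" and "l0 \<noteq> \<infinity>"
  shows "h 1 1 \<le> total_risk a0 a1 l0 l1 \<psi> \<phi>"
proof -
  have "continuing (next_group v) k \<le> stage_loss l0 l1 \<psi> \<phi> k +
      ((a0 * d0.reach \<psi> (Suc k) + a1 * d1.reach \<psi> (Suc k)) + continuing (next_group v) (Suc k))" for k
    unfolding continuing_next_group[of k] stage_loss_eq continuing_continuation_risk[symmetric]
  proof (rule add_mono)
    show "stage (Suc k) (\<lambda>n x. ennreal (stop_prob \<psi> n x) * v (joint_density f0 n x) (joint_density f1 n x)) \<le>
        stage (Suc k) (\<lambda>n x. ennreal (stop_prob \<psi> n x) *
          (l0 * (ennreal (\<phi> n x) * ennreal (joint_density f0 n x)) +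
           l1 * (ennreal (1 - \<phi> n x) * ennreal (joint_density f1 n x))))"
    proof (intro stage_mono mult_left_mono)
      fix n x assume n: "n \<in> size_vectors G (Suc k)" and x: "x \<in> space (sample_measure M n)"
      let ?v = "v (joint_density f0 n x) (joint_density f1 n x)"
      have "?v = ennreal (\<phi> n x + (1 - \<phi> n x)) * ?v" by simp
      also have "\<dots> = ennreal (\<phi> n x) * ?v + ennreal (1 - \<phi> n x) * ?v"
        using rule_bounds[OF decision n x] by (subst ennreal_plus) (auto simp: distrib_right)
      also have "\<dots> \<le> ennreal (\<phi> n x) * (l0 * ennreal (joint_density f0 n x)) +
          ennreal (1 - \<phi> n x) * (l1 * ennreal (joint_density f1 n x))"
        by (intro add_mono mult_left_mono risk_le) auto
      finally show "?v \<le> l0 * (ennreal (\<phi> n x) * ennreal (joint_density f0 n x)) +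
          l1 * (ennreal (1 - \<phi> n x) * ennreal (joint_density f1 n x))"
        by (simp add: mult_ac)
    qed auto
    show "continuing v (Suc k) \<le> continuing h (Suc k)"
      unfolding continuing_def by (intro stage_mono mult_left_mono risk_le) auto
  qed
  \<comment> \<open>The bound of \<open>v\<close> by \<open>l0 x\<close> is invariant under
    \<open>next_group\<close>, so the remainder is at most \<open>l0\<close> times the probability
    of still running under \<open>f0\<close>. Here termination and the finiteness of
    \<open>l0\<close> enter.\<close>
  moreover have "continuing (next_group v) \<longlonglongrightarrow> 0"
  proof (rule tendsto_sandwich[OF _ _ tendsto_const])
    have "continuing (next_group v) k \<le> l0 * d0.reach \<psi> k" for k
    proof -
      have "continuing (next_group v) k \<le>
          stage k (\<lambda>n x. l0 * (ennreal (continued \<psi> n x) * ennreal (joint_density f0 n x)))"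
        unfolding continuing_def
      proof (intro stage_mono)
        fix n x assume x: "x \<in> space (sample_measure M n)"
        have "next_group v (joint_density f0 n x) (joint_density f1 n x) \<le>
            next_group (\<lambda>x y. l0 * ennreal x) (joint_density f0 n x) (joint_density f1 n x)"
          by (intro next_group_mono' risk_le)
        also have "\<dots> = l0 * ennreal (joint_density f0 n x)"
          using next_group_linear[of "joint_density f0 n x" "joint_density f1 n x" l0 0]
            joint_density0_nonneg[OF x] joint_density1_nonneg[OF x] by simp
        finally show "ennreal (continued \<psi> n x) * next_group v (joint_density f0 n x) (joint_density f1 n x) \<le>
            l0 * (ennreal (continued \<psi> n x) * ennreal (joint_density f0 n x))"
          by (subst mult.left_commute) (rule mult_left_mono, auto)
      qed
      then show ?thesis
        by (simp add: d0.reach_def stage_cmult stage_measurable_continued[OF rule d0.stage_measurable_density])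
    qed
    then show "\<forall>\<^sub>F k in sequentially. continuing (next_group v) k \<le> l0 * d0.reach \<psi> k"
      by simp
    have "(\<lambda>k. l0 * d0.reach \<psi> k) \<longlonglongrightarrow> l0 * 0"
      using assms(2) by (intro ennreal_tendsto_cmult reach) (simp add: less_top)
    then show "(\<lambda>k. l0 * d0.reach \<psi> k) \<longlonglongrightarrow> 0" by simp
  qed simp
  ultimately have "(a0 * d0.reach \<psi> 0 + a1 * d1.reach \<psi> 0) + continuing (next_group v) 0 \<le>
      (\<Sum>k. a0 * d0.reach \<psi> k + a1 * d1.reach \<psi> k) + (\<Sum>k. stage_loss l0 l1 \<psi> \<phi> k)"
    by (rule ennreal_recursion_le)
  then show ?thesis
    by (simp only: total_risk_eq continuing_continuation_risk[symmetric] continuing_continuation_risk_0)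
qed

context
  fixes A B :: real
  assumes A: "0 < A" and AB: "A < B"
    and stop: "\<And>k n x. n \<in> size_vectors G (Suc k) \<Longrightarrow> x \<in> space (sample_measure M n) \<Longrightarrow> \<psi> n x \<noteq> 0 \<Longrightarrow>
      \<phi> n x = 1 \<and> B * joint_density f0 n x \<le> joint_density f1 n x \<or>
      \<phi> n x = 0 \<and> joint_density f1 n x \<le> A * joint_density f0 n x"
    and continue: "\<And>k n x. n \<in> size_vectors G (Suc k) \<Longrightarrow> x \<in> space (sample_measure M n) \<Longrightarrow> \<psi> n x \<noteq> 1 \<Longrightarrow>
      A * joint_density f0 n x \<le> joint_density f1 n x \<and> joint_density f1 n x \<le> B * joint_density f0 n x"
begin

lemma continued_nonzero:
  assumes "n \<in> size_vectors G (Suc k)" "x \<in> space (sample_measure M n)" "continued \<psi> n x \<noteq> 0"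
  shows "\<psi> n x \<noteq> 1"
proof -
  have "n \<noteq> []" using assms(1) by (auto simp: size_vectors_def)
  then show ?thesis using assms(3) continued_eq[OF _ assms(2), of \<psi>] by auto
qed

text \<open>The inequalities valid for every test become equalities: where \<open>\<psi>\<close> may
  stop, \<open>v\<close> is the loss of the decision that \<open>\<phi>\<close> makes, and where it
  may continue, \<open>v = h\<close>. Elsewhere the weights \<open>stop_prob\<close> and
  \<open>continued\<close> vanish.\<close>

lemma total_risk_le_continuation_risk:
  assumes "h 1 B = l0" "h 1 A = l1 * ennreal A"
  shows "total_risk a0 a1 l0 l1 \<psi> \<phi> \<le> h 1 1"
proof -
  note boundary = A AB assms
  have "stage_loss l0 l1 \<psi> \<phi> k +
      ((a0 * d0.reach \<psi> (Suc k) + a1 * d1.reach \<psi> (Suc k)) + continuing (next_group v) (Suc k)) \<le>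
      continuing (next_group v) k" for k
    unfolding continuing_next_group[of k] stage_loss_eq continuing_continuation_risk[symmetric]
  proof (rule add_mono)
    show "stage (Suc k) (\<lambda>n x. ennreal (stop_prob \<psi> n x) *
          (l0 * (ennreal (\<phi> n x) * ennreal (joint_density f0 n x)) +
           l1 * (ennreal (1 - \<phi> n x) * ennreal (joint_density f1 n x)))) \<le>
        stage (Suc k) (\<lambda>n x. ennreal (stop_prob \<psi> n x) * v (joint_density f0 n x) (joint_density f1 n x))"
    proof (rule stage_mono)
      fix n x assume n: "n \<in> size_vectors G (Suc k)" and x: "x \<in> space (sample_measure M n)"
      show "ennreal (stop_prob \<psi> n x) *
          (l0 * (ennreal (\<phi> n x) * ennreal (joint_density f0 n x)) +
           l1 * (ennreal (1 - \<phi> n x) * ennreal (joint_density f1 n x))) \<le>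
          ennreal (stop_prob \<psi> n x) * v (joint_density f0 n x) (joint_density f1 n x)"
      proof (cases "\<psi> n x = 0")
        case False
        from stop[OF n x False] show ?thesis
          using joint_density0_nonneg[OF x] joint_density1_nonneg[OF x]
          by (auto simp: risk_accept[OF boundary] risk_reject[OF boundary])
      qed (simp add: stop_prob_def)
    qed
    show "continuing h (Suc k) \<le> continuing v (Suc k)"
      unfolding continuing_def
    proof (rule stage_mono)
      fix n x assume n: "n \<in> size_vectors G (Suc k)" and x: "x \<in> space (sample_measure M n)"
      show "ennreal (continued \<psi> n x) * h (joint_density f0 n x) (joint_density f1 n x) \<le>
          ennreal (continued \<psi> n x) * v (joint_density f0 n x) (joint_density f1 n x)"
      proof (cases "continued \<psi> n x = 0")
        case False
        from continue[OF n x continued_nonzero[OF n x False]] show ?thesis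
          using joint_density0_nonneg[OF x] joint_density1_nonneg[OF x]
          by (simp add: risk_continue[OF boundary])
      qed simp
    qed
  qed
  then have "(\<Sum>k. a0 * d0.reach \<psi> k + a1 * d1.reach \<psi> k) + (\<Sum>k. stage_loss l0 l1 \<psi> \<phi> k) \<le>
      (a0 * d0.reach \<psi> 0 + a1 * d1.reach \<psi> 0) + continuing (next_group v) 0"
    by (rule ennreal_recursion_ge)
  then show ?thesis
    by (simp only: total_risk_eq continuing_continuation_risk[symmetric] continuing_continuation_risk_0)
qed

text \<open>While sampling continues, multiplying \<open>A f0 \<le> f1\<close> by \<open>f0\<close>
  and \<open>f1 \<le> B f0\<close> by \<open>f1\<close> bounds both joint densities by a constant
  times the root of their product. Its integral is \<open>group_affinity ^ k\<close>, which decays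
  geometrically.\<close>

lemma reach_tendsto_0: "d0.reach \<psi> \<longlonglongrightarrow> 0" "d1.reach \<psi> \<longlonglongrightarrow> 0"
proof -
  have meas: "case_prod (\<lambda>x y. ennreal (sqrt (x * y))) \<in> borel_measurable (borel \<Otimes>\<^sub>M borel)"
    by (simp add: case_prod_unfold)
  have aux: "(\<lambda>k. stage k (\<lambda>n x. ennreal (continued \<psi> n x) * ennreal (g n x))) \<longlonglongrightarrow> 0"
    if "0 \<le> t" and g: "\<And>k n x. n \<in> size_vectors G (Suc k) \<Longrightarrow> x \<in> space (sample_measure M n) \<Longrightarrow> \<psi> n x \<noteq> 1 \<Longrightarrow>
      g n x \<le> t * sqrt (joint_density f0 n x * joint_density f1 n x)" for t g
  proof (rule LIMSEQ_imp_Suc, rule tendsto_sandwich[OF _ _ tendsto_const])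
    have "stage (Suc k) (\<lambda>n x. ennreal (continued \<psi> n x) * ennreal (g n x)) \<le> ennreal t * group_affinity ^ Suc k" for k
    proof -
      have "stage (Suc k) (\<lambda>n x. ennreal (continued \<psi> n x) * ennreal (g n x)) \<le>
          stage (Suc k) (\<lambda>n x. ennreal t * ennreal (sqrt (joint_density f0 n x * joint_density f1 n x)))"
      proof (rule stage_mono)
        fix n x assume n: "n \<in> size_vectors G (Suc k)" and x: "x \<in> space (sample_measure M n)"
        show "ennreal (continued \<psi> n x) * ennreal (g n x) \<le>
            ennreal t * ennreal (sqrt (joint_density f0 n x * joint_density f1 n x))"
        proof (cases "continued \<psi> n x = 0")
          case False
          have "ennreal (continued \<psi> n x) * ennreal (g n x) \<le> 1 * ennreal (g n x)"
            using continued_bounds[OF rule n x] by (intro mult_right_mono) (auto simp: ennreal_le_1)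
          also have "\<dots> \<le> ennreal (t * sqrt (joint_density f0 n x * joint_density f1 n x))"
            using g[OF n x continued_nonzero[OF n x False]] by (simp add: ennreal_leI)
          finally show ?thesis using \<open>0 \<le> t\<close> by (simp add: ennreal_mult')
        qed simp
      qed
      then show ?thesis
        by (simp only: stage_cmult[OF stage_measurable_joint[OF meas]] stage_affinity)
    qed
    then show "\<forall>\<^sub>F k in sequentially. stage (Suc k) (\<lambda>n x. ennreal (continued \<psi> n x) * ennreal (g n x)) \<le>
        ennreal t * group_affinity ^ Suc k"
      by simp
    have "(\<lambda>k. ennreal t * group_affinity ^ Suc k) \<longlonglongrightarrow> ennreal t * 0"
      by (intro ennreal_tendsto_cmult LIMSEQ_Suc[OF group_affinity_power_tendsto_0]) simp
    then show "(\<lambda>k. ennreal t * group_affinity ^ Suc k) \<longlonglongrightarrow> 0" by simp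
  qed simp
  show "d0.reach \<psi> \<longlonglongrightarrow> 0"
    unfolding d0.reach_def[abs_def]
  proof (rule aux)
    show "0 \<le> sqrt (1 / A)" using A by simp
    fix k n x assume n: "n \<in> size_vectors G (Suc k)" and x: "x \<in> space (sample_measure M n)" and "\<psi> n x \<noteq> 1"
    then have "A * joint_density f0 n x \<le> joint_density f1 n x" using continue by blast
    then have "joint_density f0 n x * (A * joint_density f0 n x) \<le> joint_density f0 n x * joint_density f1 n x"
      using joint_density0_nonneg[OF x] by (rule mult_left_mono)
    then have "(joint_density f0 n x)\<^sup>2 \<le> 1 / A * (joint_density f0 n x * joint_density f1 n x)"
      using A by (simp add: field_simps power2_eq_square)
    then show "joint_density f0 n x \<le> sqrt (1 / A) * sqrt (joint_density f0 n x * joint_density f1 n x)"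
      unfolding real_sqrt_mult[symmetric] by (rule real_le_rsqrt)
  qed
  show "d1.reach \<psi> \<longlonglongrightarrow> 0"
    unfolding d1.reach_def[abs_def]
  proof (rule aux)
    show "0 \<le> sqrt B" using A AB by simp
    fix k n x assume n: "n \<in> size_vectors G (Suc k)" and x: "x \<in> space (sample_measure M n)" and "\<psi> n x \<noteq> 1"
    then have "joint_density f1 n x \<le> B * joint_density f0 n x" using continue by blast
    then have "joint_density f1 n x * joint_density f1 n x \<le> B * joint_density f0 n x * joint_density f1 n x"
      using joint_density1_nonneg[OF x] by (rule mult_right_mono)
    then have "(joint_density f1 n x)\<^sup>2 \<le> B * (joint_density f0 n x * joint_density f1 n x)"
      by (simp add: power2_eq_square mult.assoc)
    then show "joint_density f1 n x \<le> sqrt B * sqrt (joint_density f0 n x * joint_density f1 n x)"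
      unfolding real_sqrt_mult[symmetric] by (rule real_le_rsqrt)
  qed
qed

end

end

end

text \<open>Lagrangian sufficiency. Cancellation in \<open>ennreal\<close> needs finite terms, which
  the finite left-hand side supplies, while \<open>K'\<close> may be infinite; positive multipliers
  make an improved error strictly visible.\<close>

lemma ennreal_lagrange:
  fixes K K' l0 l1 a b a' b' :: ennreal
  assumes le: "K + (l0 * a + l1 * b) \<le> K' + (l0 * a' + l1 * b')"
    and fin: "K + (l0 * a + l1 * b) \<noteq> \<infinity>"
    and l: "0 < l0" "l0 \<noteq> \<infinity>" "0 < l1" "l1 \<noteq> \<infinity>"
    and "a' \<le> a" "b' \<le> b"
  shows "K \<le> K' \<and> (a' < a \<or> b' < b \<longrightarrow> K < K')"
proof -
  have fin': "K \<noteq> \<infinity>" "l0 * a \<noteq> \<infinity>" "l1 * b \<noteq> \<infinity>"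
    using fin by (auto simp: ennreal_add_eq_top)
  have la: "l0 * a' \<le> l0 * a" and lb: "l1 * b' \<le> l1 * b"
    using assms by (auto intro: mult_left_mono)
  have "K + (l0 * a + l1 * b) \<le> K' + (l0 * a + l1 * b)"
    by (rule order_trans[OF le]) (intro add_left_mono add_mono la lb)
  then have "(l0 * a + l1 * b) + K \<le> (l0 * a + l1 * b) + K'"
    by (simp only: add.commute)
  then have "K \<le> K'"
    using fin' by (simp add: ennreal_add_left_cancel_le ennreal_add_eq_top)
  moreover have "K < K'" if strict: "a' < a \<or> b' < b"
  proof (rule ccontr)
    assume "\<not> K < K'"
    then have "K + (l0 * a + l1 * b) \<le> K + (l0 * a' + l1 * b')"
      using le by (meson add_right_mono not_less order_trans)
    then have *: "l0 * a + l1 * b \<le> l0 * a' + l1 * b'"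
      using fin' by (simp add: ennreal_add_left_cancel_le)
    \<comment> \<open>Replacing the other primed term by its larger unprimed counterpart isolates
      each product, so neither error can have dropped.\<close>
    have "l1 * b + l0 * a \<le> l1 * b + l0 * a'"
      using order_trans[OF * add_left_mono[OF lb]] by (simp add: add.commute)
    then have "l0 * a \<le> l0 * a'"
      using fin' by (simp add: ennreal_add_left_cancel_le)
    moreover have "l0 * a + l1 * b \<le> l0 * a + l1 * b'"
      using order_trans[OF * add_right_mono[OF la]] .
    then have "l1 * b \<le> l1 * b'"
      using fin' by (simp add: ennreal_add_left_cancel_le)
    ultimately have "a \<le> a'" "b \<le> b'"
      using l by (auto simp: ennreal_mult_le_mult_iff)
    with strict show False by auto
  qed
  ultimately show ?thesis by blast
qed

section \<open>The multipliers belonging to given thresholds\<close>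

context group_testing
begin

lemma sprt_minimizes_total_risk:
  assumes rule: "randomized_rule M G \<psi>" and decision: "randomized_rule M G \<phi>"
    and A: "0 < A" and AB: "A < B"
    and stop: "\<And>k n x. n \<in> size_vectors G (Suc k) \<Longrightarrow> x \<in> space (sample_measure M n) \<Longrightarrow> \<psi> n x \<noteq> 0 \<Longrightarrow>
      \<phi> n x = 1 \<and> B * joint_density f0 n x \<le> joint_density f1 n x \<or>
      \<phi> n x = 0 \<and> joint_density f1 n x \<le> A * joint_density f0 n x"
    and continue: "\<And>k n x. n \<in> size_vectors G (Suc k) \<Longrightarrow> x \<in> space (sample_measure M n) \<Longrightarrow> \<psi> n x \<noteq> 1 \<Longrightarrow>
      A * joint_density f0 n x \<le> joint_density f1 n x \<and> joint_density f1 n x \<le> B * joint_density f0 n x"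
    and a: "a0 \<noteq> \<infinity>" "a1 \<noteq> \<infinity>" "a0 + a1 \<noteq> 0"
  obtains l0 l1 where "0 < l0" "l0 \<noteq> \<infinity>" "0 < l1" "l1 \<noteq> \<infinity>"
    "total_risk a0 a1 l0 l1 \<psi> \<phi> \<noteq> \<infinity>"
    "\<And>\<psi>' \<phi>'. randomized_rule M G \<psi>' \<Longrightarrow> randomized_rule M G \<phi>' \<Longrightarrow> d0.reach \<psi>' \<longlonglongrightarrow> 0 \<Longrightarrow>
      total_risk a0 a1 l0 l1 \<psi> \<phi> \<le> total_risk a0 a1 l0 l1 \<psi>' \<phi>'"
proof -
  have B: "0 < B" using A AB by simp
  obtain l0 l1 where l: "l0 \<noteq> \<infinity>" "l1 \<noteq> \<infinity>"
    and at_B: "continuation_risk a0 a1 l0 l1 1 B = l0"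
    and at_A: "continuation_risk a0 a1 l0 l1 1 A = l1 * ennreal A"
    by (rule stopping_costs_exist[OF A B a(1,2)])
  \<comment> \<open>Both coordinates of \<open>(1, t)\<close> are positive, so a price under either
    hypothesis alone makes the continuation risk positive, and with it both losses.\<close>
  have pos: "0 < continuation_risk a0 a1 l0 l1 1 t" if "0 < t" for t
  proof -
    have "0 < a0 * ennreal 1 + a1 * ennreal t"
      using a(3) that by (auto simp: zero_less_iff_neq_zero)
    then show ?thesis
      unfolding continuation_risk_def by (rule less_le_trans) simp
  qed
  have "0 < l0" using pos[OF B] at_B by simp
  moreover have "0 < l1" using pos[OF A] at_A by (cases "l1 = 0") (auto simp: zero_less_iff_neq_zero)
  moreover note upper = total_risk_le_continuation_risk[OF rule decision A AB stop continue at_B at_A]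
  \<comment> \<open>Taking one group and then rejecting costs \<open>a0 + a1 + l0\<close>, so the
    minimal Lagrangian is finite.\<close>
  have "next_group (risk a0 a1 l0 l1) 1 1 \<le> next_group (\<lambda>x y. l0 * ennreal x + 0 * ennreal y) 1 1"
    by (intro next_group_mono') (simp add: risk_le)
  then have "next_group (risk a0 a1 l0 l1) 1 1 \<le> l0"
    by (simp add: next_group_linear del: mult_zero_left)
  then have "continuation_risk a0 a1 l0 l1 1 1 \<noteq> \<infinity>"
    using a l by (auto simp: continuation_risk_def ennreal_add_eq_top top_unique)
  then have "total_risk a0 a1 l0 l1 \<psi> \<phi> \<noteq> \<infinity>"
    using upper by (auto simp: top_unique)
  moreover have "total_risk a0 a1 l0 l1 \<psi> \<phi> \<le> total_risk a0 a1 l0 l1 \<psi>' \<phi>'"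
    if "randomized_rule M G \<psi>'" "randomized_rule M G \<phi>'" "d0.reach \<psi>' \<longlonglongrightarrow> 0" for \<psi>' \<phi>'
    using upper continuation_risk_le_total_risk[OF that l(1)] by (rule order_trans)
  ultimately show ?thesis using l that by blast
qed

end

section \<open>Translation of the likelihood ratio into densities and the final comparison\<close>

lemma measurable_likelihood_ratio:
  assumes [measurable]: "f0 \<in> borel_measurable M" "f1 \<in> borel_measurable M"
  shows "likelihood_ratio f0 f1 z00 n \<in> borel_measurable (sample_measure M n)"
  unfolding likelihood_ratio_def[abs_def] by measurable

theorem theorem5p1:
  fixes M :: "'a measure" and f0 f1 :: "'a \<Rightarrow> real"
    and G :: "nat set" and p :: "nat pmf" and c :: "nat \<Rightarrow> real"
    and z00 :: ennreal and A B :: real and \<psi> \<phi> :: "'a rule"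
  assumes "sigma_finite_measure M"
    and "f0 \<in> borel_measurable M" and "\<And>x. x \<in> space M \<Longrightarrow> 0 \<le> f0 x"
    and "(\<integral>\<^sup>+ x. ennreal (f0 x) \<partial>M) = 1"
    and "f1 \<in> borel_measurable M" and "\<And>x. x \<in> space M \<Longrightarrow> 0 \<le> f1 x"
    and "(\<integral>\<^sup>+ x. ennreal (f1 x) \<partial>M) = 1"
    and "emeasure M {x \<in> space M. f0 x \<noteq> f1 x} > 0"
    and "set_pmf p \<subseteq> G" and "pmf p 0 < 1"
    and "\<And>m. m \<in> G \<Longrightarrow> 0 < c m"
    and "0 < (\<Sum>\<^sub>\<infinity>m\<in>G. ennreal (pmf p m * c m))"
    and "(\<Sum>\<^sub>\<infinity>m\<in>G. ennreal (pmf p m * c m)) < \<infinity>"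
    and "0 < A" and "A < B"
    and "randomized_rule M G \<psi>"
    and "\<And>k n x. \<lbrakk>k \<ge> 1; n \<in> size_vectors G k; x \<in> space (sample_measure M n)\<rbrakk> \<Longrightarrow>
           indicator {ennreal A<..<ennreal B} (likelihood_ratio f0 f1 z00 n x) \<le> 1 - \<psi> n x \<and>
           1 - \<psi> n x \<le> indicator {ennreal A..ennreal B} (likelihood_ratio f0 f1 z00 n x)"
    and "\<And>k n x. \<lbrakk>k \<ge> 1; n \<in> size_vectors G k; x \<in> space (sample_measure M n)\<rbrakk> \<Longrightarrow>
           \<phi> n x = indicator {ennreal B..} (likelihood_ratio f0 f1 z00 n x)"
  shows "(\<psi>, \<phi>) \<in> terminating_tests M G p f0 \<inter> terminating_tests M G p f1 \<and>
    (\<forall>\<psi>' \<phi>'.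
       (\<psi>', \<phi>') \<in> terminating_tests M G p f0 \<inter> terminating_tests M G p f1 \<and>
       error_prob1 M G p f0 \<psi>' \<phi>' \<le> error_prob1 M G p f0 \<psi> \<phi> \<and>
       error_prob2 M G p f1 \<psi>' \<phi>' \<le> error_prob2 M G p f1 \<psi> \<phi> \<longrightarrow>
       average_cost M G p c f0 \<psi> \<le> average_cost M G p c f0 \<psi>' \<and>
       average_cost M G p c f1 \<psi> \<le> average_cost M G p c f1 \<psi>' \<and>
       (error_prob1 M G p f0 \<psi>' \<phi>' < error_prob1 M G p f0 \<psi> \<phi> \<or>
        error_prob2 M G p f1 \<psi>' \<phi>' < error_prob2 M G p f1 \<psi> \<phi> \<longrightarrow>
        average_cost M G p c f0 \<psi> < average_cost M G p c f0 \<psi>' \<and>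
        average_cost M G p c f1 \<psi> < average_cost M G p c f1 \<psi>'))"
proof -
  interpret sigma_finite_measure M by (rule assms(1))
  interpret group_testing M f0 f1 p G
    by unfold_locales (use assms in auto)
  note rule = \<open>randomized_rule M G \<psi>\<close> and A = \<open>0 < A\<close> and AB = \<open>A < B\<close>
  have decision: "randomized_rule M G \<phi>"
    unfolding randomized_rule_def
  proof (intro allI impI ballI conjI)
    fix k n assume kn: "1 \<le> k" "n \<in> size_vectors G k"
    have "(\<lambda>x. indicator {ennreal B..} (likelihood_ratio f0 f1 z00 n x) :: real) \<in> borel_measurable (sample_measure M n)"
      by (rule measurable_compose[OF measurable_likelihood_ratio]) (use assms in auto)
    then show "\<phi> n \<in> borel_measurable (sample_measure M n)"
      by (subst measurable_cong[OF assms(18)[OF kn]])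
    fix x assume "x \<in> space (sample_measure M n)"
    then show "0 \<le> \<phi> n x" "\<phi> n x \<le> 1"
      using assms(18)[OF kn] by auto
  qed
  have B: "0 < B" using A AB by simp
  have ratio: "ennreal t \<le> likelihood_ratio f0 f1 z00 n x \<longleftrightarrow> t * joint_density f0 n x \<le> joint_density f1 n x"
    "likelihood_ratio f0 f1 z00 n x \<le> ennreal t \<longleftrightarrow> joint_density f1 n x \<le> t * joint_density f0 n x"
    if t: "0 < t" and pos: "0 < joint_density f0 n x" and x: "x \<in> space (sample_measure M n)" for t n x
  proof -
    have z: "likelihood_ratio f0 f1 z00 n x = ennreal (joint_density f1 n x / joint_density f0 n x)"
      using pos by (simp add: likelihood_ratio_def)
    have "0 \<le> joint_density f1 n x / joint_density f0 n x"
      using pos joint_density1_nonneg[OF x] by simp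
    then show "ennreal t \<le> likelihood_ratio f0 f1 z00 n x \<longleftrightarrow> t * joint_density f0 n x \<le> joint_density f1 n x"
      by (simp only: z ennreal_le_iff pos_le_divide_eq[OF pos])
    show "likelihood_ratio f0 f1 z00 n x \<le> ennreal t \<longleftrightarrow> joint_density f1 n x \<le> t * joint_density f0 n x"
      using t by (simp only: z ennreal_le_iff less_imp_le pos_divide_le_eq[OF pos])
  qed
  have stop: "\<phi> n x = 1 \<and> B * joint_density f0 n x \<le> joint_density f1 n x \<or>
      \<phi> n x = 0 \<and> joint_density f1 n x \<le> A * joint_density f0 n x"
    if n: "n \<in> size_vectors G (Suc k)" and x: "x \<in> space (sample_measure M n)" and "\<psi> n x \<noteq> 0" for k n x
  proof -
    let ?z = "likelihood_ratio f0 f1 z00 n x"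
    have z: "?z \<notin> {ennreal A<..<ennreal B}"
      using assms(17)[OF _ n x] rule_bounds[OF rule n x] \<open>\<psi> n x \<noteq> 0\<close> by (auto split: split_indicator_asm)
    have \<phi>: "\<phi> n x = indicator {ennreal B..} ?z"
      using assms(18)[OF _ n x] by simp
    show ?thesis
    proof (cases "0 < joint_density f0 n x")
      case True
      show ?thesis
      proof (cases "ennreal B \<le> ?z")
        case reject: True
        then show ?thesis using \<phi> ratio(1)[OF B True x] by simp
      next
        case False
        then have "?z \<le> ennreal A" using z by auto
        then show ?thesis using \<phi> False ratio(2)[OF A True x] by simp
      qed
    next
      case False
      then have null: "joint_density f0 n x = 0"
        using joint_density0_nonneg[OF x] by simp
      \<comment> \<open>Where both densities vanish, both density inequalities hold, so either
        decision induced by \<open>z00\<close> is admissible; where only \<open>f0\<close> vanishes,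
        the infinite ratio forces rejection.\<close>
      show ?thesis
      proof (cases "joint_density f1 n x = 0")
        case True
        then show ?thesis using \<phi> null by (cases "ennreal B \<le> ?z") simp_all
      next
        case False
        then have pos: "0 < joint_density f1 n x"
          using joint_density1_nonneg[OF x] by simp
        then have "?z = \<infinity>" using null by (simp add: likelihood_ratio_def)
        then show ?thesis using \<phi> null pos by simp
      qed
    qed
  qed
  have continue: "A * joint_density f0 n x \<le> joint_density f1 n x \<and> joint_density f1 n x \<le> B * joint_density f0 n x"
    if n: "n \<in> size_vectors G (Suc k)" and x: "x \<in> space (sample_measure M n)" and "\<psi> n x \<noteq> 1" for k n x
  proof -
    let ?z = "likelihood_ratio f0 f1 z00 n x"
    have z: "ennreal A \<le> ?z" "?z \<le> ennreal B"
      using assms(17)[OF _ n x] rule_bounds[OF rule n x] \<open>\<psi> n x \<noteq> 1\<close> by (auto split: split_indicator_asm)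
    show ?thesis
    proof (cases "0 < joint_density f0 n x")
      case True
      with z show ?thesis using ratio(1)[OF A True x] ratio(2)[OF B True x] by simp
    next
      case False
      then have null: "joint_density f0 n x = 0"
        using joint_density0_nonneg[OF x] by simp
      then have "\<not> 0 < joint_density f1 n x"
        using z(2) by (auto simp: likelihood_ratio_def top_unique)
      then show ?thesis using null joint_density1_nonneg[OF x] by simp
    qed
  qed
  have reach: "d0.reach \<psi> \<longlonglongrightarrow> 0" "d1.reach \<psi> \<longlonglongrightarrow> 0"
    using reach_tendsto_0[OF rule decision A AB stop continue] by auto
  define C where "C = (\<integral>\<^sup>+m. ennreal (c m) \<partial>p)"
  have "(\<Sum>\<^sub>\<infinity>m\<in>G. ennreal (pmf p m * c m)) = (\<Sum>\<^sub>\<infinity>m\<in>G. ennreal (pmf p m) * ennreal (c m))"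
    by (intro infsum_cong ennreal_mult') simp
  then have "(\<Sum>\<^sub>\<infinity>m\<in>G. ennreal (pmf p m * c m)) = C"
    by (simp add: C_def infsum_pmf_eq_nn_integral[OF assms(9)])
  with assms(12,13) have C: "C \<noteq> \<infinity>" "C \<noteq> 0" by auto
  have c: "\<And>m. m \<in> G \<Longrightarrow> 0 \<le> c m" using assms(11) less_imp_le by blast
  have cost: "average_cost M G p c f0 \<psi>' = C * (\<Sum>k. d0.reach \<psi>' k)"
    "average_cost M G p c f1 \<psi>' = C * (\<Sum>k. d1.reach \<psi>' k)"
    if "randomized_rule M G \<psi>'" "d0.reach \<psi>' \<longlonglongrightarrow> 0" "d1.reach \<psi>' \<longlonglongrightarrow> 0" for \<psi>'
    using d0.average_cost_wald[OF that(1) c that(2)] d1.average_cost_wald[OF that(1) c that(3)]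
    by (simp_all add: C_def)
  note minimizes = sprt_minimizes_total_risk[OF rule decision A AB stop continue]
  show ?thesis
  proof (intro conjI allI impI; (elim conjE)?)
    show "(\<psi>, \<phi>) \<in> terminating_tests M G p f0 \<inter> terminating_tests M G p f1"
      using reach decision d0.terminating_iff_reach[OF rule] d1.terminating_iff_reach[OF rule]
      by (simp add: terminating_tests_def)
  next
    fix \<psi>' \<phi>'
    assume "(\<psi>', \<phi>') \<in> terminating_tests M G p f0 \<inter> terminating_tests M G p f1"
      and errors: "error_prob1 M G p f0 \<psi>' \<phi>' \<le> error_prob1 M G p f0 \<psi> \<phi>"
        "error_prob2 M G p f1 \<psi>' \<phi>' \<le> error_prob2 M G p f1 \<psi> \<phi>"
    then have rule': "randomized_rule M G \<psi>'" and decision': "randomized_rule M G \<phi>'"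
      and "\<psi>' \<in> terminating_rules M G p f0" "\<psi>' \<in> terminating_rules M G p f1"
      by (auto simp: terminating_tests_def terminating_rules_def)
    then have reach': "d0.reach \<psi>' \<longlonglongrightarrow> 0" "d1.reach \<psi>' \<longlonglongrightarrow> 0"
      using d0.terminating_iff_reach[OF rule'] d1.terminating_iff_reach[OF rule'] by auto
    let ?strict = "error_prob1 M G p f0 \<psi>' \<phi>' < error_prob1 M G p f0 \<psi> \<phi> \<or>
        error_prob2 M G p f1 \<psi>' \<phi>' < error_prob2 M G p f1 \<psi> \<phi>"
    \<comment> \<open>With price \<open>C\<close> under one hypothesis and 0 under the other,
      \<open>cost\<close> identifies the sampling part of \<open>total_risk\<close> with a single
      average cost.\<close>
    have 0: "average_cost M G p c f0 \<psi> \<le> average_cost M G p c f0 \<psi>' \<and>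
        (?strict \<longrightarrow> average_cost M G p c f0 \<psi> < average_cost M G p c f0 \<psi>')"
    proof (rule minimizes[where ?a0.0 = C and ?a1.0 = 0])
      fix l0 l1 assume "0 < l0" "l0 \<noteq> \<infinity>" "0 < l1" "l1 \<noteq> \<infinity>" "total_risk C 0 l0 l1 \<psi> \<phi> \<noteq> \<infinity>"
        and opt: "\<And>\<psi>' \<phi>'. randomized_rule M G \<psi>' \<Longrightarrow> randomized_rule M G \<phi>' \<Longrightarrow> d0.reach \<psi>' \<longlonglongrightarrow> 0 \<Longrightarrow>
          total_risk C 0 l0 l1 \<psi> \<phi> \<le> total_risk C 0 l0 l1 \<psi>' \<phi>'"
      then show ?thesis
        using opt[OF rule' decision' reach'(1)] errors
        unfolding total_risk_def cost[OF rule reach] cost[OF rule' reach']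
        by (intro ennreal_lagrange[where ?l0.0 = l0 and ?l1.0 = l1]) auto
    qed (use C in auto)
    have 1: "average_cost M G p c f1 \<psi> \<le> average_cost M G p c f1 \<psi>' \<and>
        (?strict \<longrightarrow> average_cost M G p c f1 \<psi> < average_cost M G p c f1 \<psi>')"
    proof (rule minimizes[where ?a0.0 = 0 and ?a1.0 = C])
      fix l0 l1 assume "0 < l0" "l0 \<noteq> \<infinity>" "0 < l1" "l1 \<noteq> \<infinity>" "total_risk 0 C l0 l1 \<psi> \<phi> \<noteq> \<infinity>"
        and opt: "\<And>\<psi>' \<phi>'. randomized_rule M G \<psi>' \<Longrightarrow> randomized_rule M G \<phi>' \<Longrightarrow> d0.reach \<psi>' \<longlonglongrightarrow> 0 \<Longrightarrow>
          total_risk 0 C l0 l1 \<psi> \<phi> \<le> total_risk 0 C l0 l1 \<psi>' \<phi>'"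
      then show ?thesis
        using opt[OF rule' decision' reach'(1)] errors
        unfolding total_risk_def cost[OF rule reach] cost[OF rule' reach']
        by (intro ennreal_lagrange[where ?l0.0 = l0 and ?l1.0 = l1]) auto
    qed (use C in auto)
    show "average_cost M G p c f0 \<psi> \<le> average_cost M G p c f0 \<psi>'"
      and "average_cost M G p c f1 \<psi> \<le> average_cost M G p c f1 \<psi>'"
      using 0 1 by auto
    assume ?strict
    then show "average_cost M G p c f0 \<psi> < average_cost M G p c f0 \<psi>'"
      and "average_cost M G p c f1 \<psi> < average_cost M G p c f1 \<psi>'"
      using 0 1 by auto
  qed
qed

end
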